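(* Put $$a_n=M_n(t_1r,t_2r,t_3/r,t_4/r),\qquad b_n=M_n(t_1,t_2,t_3,t_4),\qquad c_n=\frac{(r^2t_1t_2q^n;q)_\infty}{(t_1t_2q^n;q)_\infty}\,r^n,$$ $$\begin{aligned}k_0(\cos\phi_1,\cos\phi_2)={}&\frac{w_H(\cos\phi_1|q)(r^2;q)_\infty}{h(\cos\phi_1;t_1,t_2)}\,\frac{w_H(\cos\phi_2|q)(r^2;q)_\infty}{h(\cos\phi_2;t_1,t_2)}\,\frac{\sin\phi_1\sin\phi_2}{w(\cos\phi_2;t_1,t_2,t_3,t_4)}\\&\times\int_0^\pi\frac{W_0(\cos\theta\mid t_1r,t_2r,t_3/r,t_4/r)}{h(\cos\phi_1;re^{i\theta},re^{-i\theta})\,h(\cos\phi_2;re^{i\theta},re^{-i\theta})}\,d\theta,\end{aligned}$$ where $$W_0(\cos\theta\mid t_1r,t_2r,t_3/r,t_4/r)=w(\cos\theta;t_1r,t_2r,t_3/r,t_4/r)\,h^2(\cos\theta;t_1r,t_2r).$$ Then the following bilinear formula for the Askey--Wilson polynomials holds: $$\frac{k_0(\cos\phi_1,\cos\phi_2)}{w(\cos\phi_1;t_1,t_2,t_3,t_4)}=\sum_{n=0}^\infty a_n\Big(\frac{c_n}{b_n}\Big)^2p_n(\cos\phi_1;t_1,t_2,t_3,t_4)\,p_n(\cos\phi_2;t_1,t_2,t_3,t_4).$$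
   Context: Throughout $0<q<1$, $-1<r<1$, $(A;q)_\infty=\prod_{k\ge0}(1-Aq^k)$, $(A;q)_n=\prod_{k=0}^{n-1}(1-Aq^k)$, $(A_1,\dots,A_m;q)_n=\prod_j(A_j;q)_n$ (also for $n=\infty$), ${}_{4}\phi_3\big({\alpha_1,\dots,\alpha_{4}\atop\beta_1,\beta_2,\beta_3}\big|q,x\big)=\sum_{k\ge0}\frac{(\alpha_1,\dots,\alpha_{4};q)_k}{(q,\beta_1,\beta_2,\beta_3;q)_k}x^k$, and $h(\cos\theta;a_1,\dots,a_n)=\prod_{j=1}^n(a_je^{i\theta},a_je^{-i\theta};q)_\infty$. The Askey--Wilson polynomials are $$p_n(\cos\theta;t_1,t_2,t_3,t_4)=(t_1t_2,t_1t_3,t_1t_4;q)_n\,t_1^{-n}\,{}_4\phi_3\left(\begin{matrix}q^{-n},q^{n-1}t_1t_2t_3t_4,t_1e^{i\theta},t_1e^{-i\theta}\\t_1t_2,t_1t_3,t_1t_4\end{matrix}\Big|q,q\right),$$ their weight function is $$w(\cos\theta;t_1,t_2,t_3,t_4)=\frac{(e^{2i\theta},e^{-2i\theta};q)_\infty}{\prod_{j=1}^4(t_je^{i\theta},t_je^{-i\theta};q)_\infty},$$ and the constants in their orthogonality relation $\int_0^\pi p_mp_nw\,d\theta=M_n\delta_{m,n}$ are $$M_n(t_1,t_2,t_3,t_4)=\frac{2\pi(t_1t_2t_3t_4q^{2n};q)_\infty(t_1t_2t_3t_4q^{n-1};q)_n}{(q^{n+1};q)_\infty\prod_{1\le j<k\le4}(t_jt_kq^n;q)_\infty}.$$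 Also $w_H(x|q)=\frac{(q,e^{2i\theta},e^{-2i\theta};q)_\infty}{2\pi\sqrt{1-x^2}}$, $x=\cos\theta$, is the normalized continuous $q$-Hermite weight.
   Formalization: Assumed: complex t_j with |t_1|,...,|t_4|<1 and |t_3/r|,|t_4/r|<1 (the range of the stated orthogonality relation for both parameter sets; the formula fails for |t_3|>|r|), r and t_1 nonzero, and 0<φ_1,φ_2<π so that all quotients are defined. *)

theory Defs
  imports "HOL-Analysis.Analysis"
begin

text \<open>
  Base \<open>q\<close> real, parameters complex. A function of \<open>x = cos \<theta>\<close> that is given by a formula in
  \<open>exp (\<i> \<theta>)\<close> is represented as a function of the angle \<open>\<theta>\<close>; all the expressions below are
  invariant under \<open>\<theta> \<mapsto> -\<theta>\<close> and \<open>\<theta> \<mapsto> \<theta> + 2 \<pi>\<close>, unless they involve \<open>sin\<close>.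
\<close>

definition qpoch :: "real \<Rightarrow> complex \<Rightarrow> nat \<Rightarrow> complex" where
  "qpoch q A n = (\<Prod>k<n. 1 - A * of_real q ^ k)"

definition qpoch_inf :: "real \<Rightarrow> complex \<Rightarrow> complex" where
  "qpoch_inf q A = (\<Prod>k. 1 - A * of_real q ^ k)"

definition qpochs :: "real \<Rightarrow> complex list \<Rightarrow> nat \<Rightarrow> complex" where
  "qpochs q As n = (\<Prod>A\<leftarrow>As. qpoch q A n)"

definition qpochs_inf :: "real \<Rightarrow> complex list \<Rightarrow> complex" where
  "qpochs_inf q As = (\<Prod>A\<leftarrow>As. qpoch_inf q A)"

text \<open>The series \<open>\<^sub>m\<^sub>+\<^sub>1\<phi>\<^sub>m\<close>, for \<open>length as = length bs + 1\<close>.\<close>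

definition qhyper :: "real \<Rightarrow> complex list \<Rightarrow> complex list \<Rightarrow> complex \<Rightarrow> complex" where
  "qhyper q as bs x = (\<Sum>k. qpochs q as k / qpochs q (of_real q # bs) k * x ^ k)"

definition h_prod :: "real \<Rightarrow> complex list \<Rightarrow> real \<Rightarrow> complex" where
  "h_prod q as \<theta> = (\<Prod>a\<leftarrow>as. qpochs_inf q [a * exp (\<i> * of_real \<theta>), a * exp (- \<i> * of_real \<theta>)])"

text \<open>
  As \<open>t\<^sub>1\<close> is inverted, this represents the Askey--Wilson polynomials only for \<open>t\<^sub>1 \<noteq> 0\<close>.
  The series terminates because \<open>qpoch q (q powi - n) k = 0\<close> for \<open>k > n\<close>.
\<close>

definition aw_poly ::
  "real \<Rightarrow> nat \<Rightarrow> complex \<Rightarrow> complex \<Rightarrow> complex \<Rightarrow> complex \<Rightarrow> real \<Rightarrow> complex" where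
  "aw_poly q n t1 t2 t3 t4 \<theta> =
     qpochs q [t1 * t2, t1 * t3, t1 * t4] n * t1 powi (- int n) *
     qhyper q
       [of_real q powi (- int n), of_real q powi (int n - 1) * t1 * t2 * t3 * t4,
        t1 * exp (\<i> * of_real \<theta>), t1 * exp (- \<i> * of_real \<theta>)]
       [t1 * t2, t1 * t3, t1 * t4]
       (of_real q)"

definition aw_weight ::
  "real \<Rightarrow> complex \<Rightarrow> complex \<Rightarrow> complex \<Rightarrow> complex \<Rightarrow> real \<Rightarrow> complex" where
  "aw_weight q t1 t2 t3 t4 \<theta> =
     qpochs_inf q [exp (2 * \<i> * of_real \<theta>), exp (- 2 * \<i> * of_real \<theta>)] /
     (\<Prod>t\<leftarrow>[t1, t2, t3, t4]. qpochs_inf q [t * exp (\<i> * of_real \<theta>), t * exp (- \<i> * of_real \<theta>)])"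

definition aw_norm ::
  "real \<Rightarrow> nat \<Rightarrow> complex \<Rightarrow> complex \<Rightarrow> complex \<Rightarrow> complex \<Rightarrow> complex" where
  "aw_norm q n t1 t2 t3 t4 =
     2 * of_real pi * qpoch_inf q (t1 * t2 * t3 * t4 * of_real q ^ (2 * n)) *
     qpoch q (t1 * t2 * t3 * t4 * of_real q powi (int n - 1)) n /
     (qpoch_inf q (of_real q ^ (n + 1)) *
      qpochs_inf q
        [t1 * t2 * of_real q ^ n, t1 * t3 * of_real q ^ n, t1 * t4 * of_real q ^ n,
         t2 * t3 * of_real q ^ n, t2 * t4 * of_real q ^ n, t3 * t4 * of_real q ^ n])"

definition q_hermite_weight :: "real \<Rightarrow> real \<Rightarrow> complex" where
  "q_hermite_weight q \<theta> =
     qpochs_inf q [of_real q, exp (2 * \<i> * of_real \<theta>), exp (- 2 * \<i> * of_real \<theta>)] /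
     of_real (2 * pi * sqrt (1 - (cos \<theta>)\<^sup>2))"

definition W0 ::
  "real \<Rightarrow> complex \<Rightarrow> complex \<Rightarrow> complex \<Rightarrow> complex \<Rightarrow> real \<Rightarrow> complex" where
  "W0 q s1 s2 s3 s4 \<theta> = aw_weight q s1 s2 s3 s4 \<theta> * (h_prod q [s1, s2] \<theta>)\<^sup>2"

definition connection_coeff :: "real \<Rightarrow> real \<Rightarrow> complex \<Rightarrow> complex \<Rightarrow> nat \<Rightarrow> complex" where
  "connection_coeff q r t1 t2 n =
     qpoch_inf q (of_real r ^ 2 * t1 * t2 * of_real q ^ n) /
     qpoch_inf q (t1 * t2 * of_real q ^ n) * of_real r ^ n"

definition k0 ::
  "real \<Rightarrow> real \<Rightarrow> complex \<Rightarrow> complex \<Rightarrow> complex \<Rightarrow> complex \<Rightarrow> real \<Rightarrow> real \<Rightarrow> complex" where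
  "k0 q r t1 t2 t3 t4 \<phi>1 \<phi>2 =
     q_hermite_weight q \<phi>1 * qpoch_inf q (of_real (r\<^sup>2)) / h_prod q [t1, t2] \<phi>1 *
     (q_hermite_weight q \<phi>2 * qpoch_inf q (of_real (r\<^sup>2)) / h_prod q [t1, t2] \<phi>2) *
     (of_real (sin \<phi>1 * sin \<phi>2) / aw_weight q t1 t2 t3 t4 \<phi>2) *
     integral {0..pi} (\<lambda>\<theta>.
       W0 q (t1 * of_real r) (t2 * of_real r) (t3 / of_real r) (t4 / of_real r) \<theta> /
       (h_prod q [of_real r * exp (\<i> * of_real \<theta>), of_real r * exp (- \<i> * of_real \<theta>)] \<phi>1 *
        h_prod q [of_real r * exp (\<i> * of_real \<theta>), of_real r * exp (- \<i> * of_real \<theta>)] \<phi>2))"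

end

theory Submission
  imports Defs "HOL-Complex_Analysis.Complex_Analysis"
begin

text \<open>
  Write \<open>s = (t\<^sub>1 r, t\<^sub>2 r, t\<^sub>3 / r, t\<^sub>4 / r)\<close>. The function \<open>k\<^sub>0(\<phi>\<^sub>1, \<phi>\<^sub>2) / w(\<phi>\<^sub>1; t)\<close> is the integral over \<open>\<theta>\<close> of
  \<open>K(\<phi>\<^sub>1, \<theta>) K(\<phi>\<^sub>2, \<theta>) w(\<theta>; s)\<close>, where \<open>K(\<phi>, \<theta>)\<close> is a multiple of
  \<open>h(\<phi>; t\<^sub>3, t\<^sub>4) h(\<theta>; s\<^sub>1, s\<^sub>2) / h(\<phi>; r e\<^sup>i\<^sup>\<theta>, r e\<^sup>-\<^sup>i\<^sup>\<theta>)\<close>. By the Askey--Wilson integral, integration against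
  \<open>K(\<phi>, \<theta>) w(\<phi>; t)\<close> in \<open>\<phi>\<close> maps \<open>p\<^sub>n(\<phi>; t)\<close> to \<open>c\<^sub>n p\<^sub>n(\<theta>; s)\<close>. Hence \<open>K(\<phi>, \<theta>)\<close> and the sum of
  \<open>(c\<^sub>n / b\<^sub>n) p\<^sub>n(\<phi>; t) p\<^sub>n(\<theta>; s)\<close> have the same moments with respect to \<open>w(\<phi>; t)\<close> and so coincide. The
  sum converges uniformly, as \<open>c\<^sub>n / b\<^sub>n = O(r\<^sup>n)\<close> and \<open>p\<^sub>n\<close> grows subexponentially by its three-term
  recurrence, and the formula follows by orthogonality of \<open>p\<^sub>n(\<theta>; s)\<close>.
\<close>

section \<open>Basic properties of shifted factorials\<close>

lemma qpoch_0 [simp]: "qpoch q A 0 = 1"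
  by (simp add: qpoch_def)

lemma qpoch_Suc: "qpoch q A (Suc n) = qpoch q A n * (1 - A * of_real q ^ n)"
  by (simp add: qpoch_def)

lemma qpoch_add: "qpoch q A (m + n) = qpoch q A m * qpoch q (A * of_real q ^ m) n"
  by (induction n) (simp_all add: qpoch_Suc power_add mult_ac)

lemma qpoch_Suc_left: "qpoch q A (Suc n) = (1 - A) * qpoch q (A * of_real q) n"
  using qpoch_add[of q A 1 n] by (simp add: qpoch_Suc)

lemma qpochs_simps [simp]:
  "qpochs q [] n = 1" "qpochs q (A # As) n = qpoch q A n * qpochs q As n"
  "qpochs_inf q [] = 1" "qpochs_inf q (A # As) = qpoch_inf q A * qpochs_inf q As"
  by (simp_all add: qpochs_def qpochs_inf_def)

context
  fixes q :: real
  assumes q: "0 < q" "q < 1"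
begin

lemma convergent_prod_qpoch: "convergent_prod (\<lambda>k. 1 - A * of_real q ^ k :: complex)"
proof (rule abs_convergent_prod_imp_convergent_prod)
  have "summable (\<lambda>k. norm A * q ^ k)"
    using q by (intro summable_mult summable_geometric) auto
  then show "abs_convergent_prod (\<lambda>k. 1 - A * of_real q ^ k)"
    using q by (simp add: abs_convergent_prod_conv_summable norm_mult norm_power)
qed

lemma qpoch_LIMSEQ: "(\<lambda>n. qpoch q A n) \<longlonglongrightarrow> qpoch_inf q A"
proof -
  have "(\<lambda>n. qpoch q A (Suc n)) \<longlonglongrightarrow> qpoch_inf q A"
    using convergent_prod_LIMSEQ[OF convergent_prod_qpoch[of A]]
    by (simp add: qpoch_def qpoch_inf_def lessThan_Suc_atMost)
  then show ?thesis
    by (rule LIMSEQ_imp_Suc)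
qed

lemma qpoch_inf_shift: "qpoch_inf q A = qpoch q A n * qpoch_inf q (A * of_real q ^ n)"
proof -
  have "(\<lambda>m. qpoch q A (m + n)) \<longlonglongrightarrow> qpoch_inf q A"
    using qpoch_LIMSEQ by (rule LIMSEQ_ignore_initial_segment)
  moreover have "(\<lambda>m. qpoch q A (m + n)) \<longlonglongrightarrow> qpoch q A n * qpoch_inf q (A * of_real q ^ n)"
    unfolding add.commute[of _ n] qpoch_add by (intro tendsto_intros qpoch_LIMSEQ)
  ultimately show ?thesis
    by (rule LIMSEQ_unique)
qed

lemma qpoch_inf_step: "qpoch_inf q A = (1 - A) * qpoch_inf q (A * of_real q)"
  using qpoch_inf_shift[of A 1] by (simp add: qpoch_Suc)

lemma norm_q_power_le: "norm (of_real q ^ n :: complex) \<le> 1"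
  using q by (simp add: norm_power power_le_one)

lemma norm_mult_q_power_less: "norm A < 1 \<Longrightarrow> norm (A * of_real q ^ n :: complex) < 1"
  using norm_q_power_le[of n] by (auto simp: norm_mult intro: le_less_trans[OF mult_left_le])

lemma one_minus_q_power_nz: "norm A < 1 \<Longrightarrow> 1 - A * of_real q ^ n \<noteq> (0 :: complex)"
  using norm_mult_q_power_less[of A n] by auto

lemma qpoch_nz: "norm A < 1 \<Longrightarrow> qpoch q A n \<noteq> 0"
  by (simp add: qpoch_def one_minus_q_power_nz del: right_minus_eq)

lemma qpoch_inf_nz': "(\<And>k. 1 - A * of_real q ^ k \<noteq> 0) \<Longrightarrow> qpoch_inf q A \<noteq> 0"
  unfolding qpoch_inf_def by (rule prodinf_nonzero[OF convergent_prod_qpoch])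

lemma qpoch_inf_nz: "norm A < 1 \<Longrightarrow> qpoch_inf q A \<noteq> 0"
  by (rule qpoch_inf_nz') (rule one_minus_q_power_nz)

lemma qpoch_inf_nz_circle:
  assumes "norm A = 1" "A \<noteq> 1"
  shows "qpoch_inf q A \<noteq> 0"
proof -
  have "norm (A * of_real q) < 1"
    using assms q by (simp add: norm_mult)
  then show ?thesis
    using assms qpoch_inf_nz[of "A * of_real q"] by (subst qpoch_inf_step) simp
qed

lemma qpoch_inf_0 [simp]: "qpoch_inf q 0 = 1"
  by (simp add: qpoch_inf_def)

lemma qpoch_inf_holomorphic: "qpoch_inf q holomorphic_on UNIV"
proof (rule holomorphic_uniform_sequence[where f = "\<lambda>n A. qpoch q A n"])
  show "(\<lambda>A. qpoch q A n) holomorphic_on UNIV" for n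
    unfolding qpoch_def by (intro holomorphic_intros)
  fix x :: complex
  have "uniformly_convergent_on (cball x 1) (\<lambda>N A. \<Prod>k<N. 1 + - (A * of_real q ^ k))"
  proof (rule uniformly_convergent_on_prod)
    show "uniformly_convergent_on (cball x 1) (\<lambda>N A. \<Sum>k<N. norm (- (A * of_real q ^ k)))"
    proof (rule Weierstrass_m_test')
      show "norm (norm (- (A * of_real q ^ k))) \<le> (norm x + 1) * q ^ k" if "A \<in> cball x 1" for k A
      proof -
        have "norm A \<le> norm x + 1"
          using that norm_triangle_ineq2[of A x] by (simp add: dist_norm norm_minus_commute)
        then show ?thesis
          using q by (auto simp: norm_mult norm_power intro!: mult_right_mono)
      qed
      show "summable (\<lambda>k. (norm x + 1) * q ^ k)"
        using q by (intro summable_mult summable_geometric) auto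
    qed
  qed (auto intro!: continuous_intros)
  then have "uniformly_convergent_on (cball x 1) (\<lambda>N A. qpoch q A N)"
    by (simp add: qpoch_def)
  then obtain l where l: "uniform_limit (cball x 1) (\<lambda>N A. qpoch q A N) l sequentially"
    by (auto simp: uniformly_convergent_on_def)
  have "l A = qpoch_inf q A" if "A \<in> cball x 1" for A
    using tendsto_uniform_limitI[OF l that] qpoch_LIMSEQ LIMSEQ_unique by blast
  then have "uniform_limit (cball x 1) (\<lambda>N A. qpoch q A N) (qpoch_inf q) sequentially"
    using l by (subst (asm) uniform_limit_cong'[where h = l and i = "qpoch_inf q"]) auto
  then show "\<exists>d>0. cball x d \<subseteq> UNIV \<and>
      uniform_limit (cball x d) (\<lambda>n A. qpoch q A n) (qpoch_inf q) sequentially"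
    by (intro exI[of _ 1]) auto
qed auto

lemma holomorphic_on_qpoch_inf [holomorphic_intros]:
  "f holomorphic_on S \<Longrightarrow> (\<lambda>z. qpoch_inf q (f z)) holomorphic_on S"
  using holomorphic_on_compose_gen[OF _ qpoch_inf_holomorphic, of f S] by (simp add: o_def)

lemma continuous_on_qpoch_inf [continuous_intros]:
  "continuous_on S f \<Longrightarrow> continuous_on S (\<lambda>x. qpoch_inf q (f x))"
  using continuous_on_compose2[OF holomorphic_on_imp_continuous_on[OF qpoch_inf_holomorphic]]
  by auto

lemma tendsto_qpoch_inf [tendsto_intros]:
  "(f \<longlongrightarrow> l) F \<Longrightarrow> ((\<lambda>x. qpoch_inf q (f x)) \<longlongrightarrow> qpoch_inf q l) F"
  using continuous_on_tendsto_compose[OF holomorphic_on_imp_continuous_on[OF qpoch_inf_holomorphic]]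
  by auto

lemma tendsto_q_power: "(\<lambda>n. of_real q ^ n :: complex) \<longlonglongrightarrow> 0"
  using q by (intro LIMSEQ_power_zero) auto

lemma qpoch_inf_square:
  fixes s :: complex
  assumes s: "s\<^sup>2 = of_real q"
  shows "qpoch_inf q (x\<^sup>2) = qpoch_inf q x * qpoch_inf q (- x) * qpoch_inf q (s * x) * qpoch_inf q (- s * x)"
proof -
  have "qpoch q (x\<^sup>2) (2 * n) = qpoch q x n * qpoch q (- x) n * qpoch q (s * x) n * qpoch q (- s * x) n" for n
  proof (induction n)
    case (Suc n)
    have "(1 - x\<^sup>2 * of_real q ^ (2 * n)) = (1 - x * of_real q ^ n) * (1 + x * of_real q ^ n)"
      by (simp add: algebra_simps power_mult power2_eq_square power_mult_distrib)
    moreover have "(1 - x\<^sup>2 * of_real q ^ Suc (2 * n)) = (1 - s * x * of_real q ^ n) * (1 + s * x * of_real q ^ n)"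
      by (simp add: algebra_simps power_mult power2_eq_square power_mult_distrib flip: s)
    ultimately show ?case
      using Suc by (simp add: qpoch_Suc mult_ac)
  qed simp
  moreover have "(\<lambda>n. qpoch q (x\<^sup>2) (2 * n)) \<longlonglongrightarrow> qpoch_inf q (x\<^sup>2)"
    using LIMSEQ_subseq_LIMSEQ[OF qpoch_LIMSEQ, of "\<lambda>n. 2 * n"] by (simp add: strict_mono_def o_def)
  moreover have "(\<lambda>n. qpoch q x n * qpoch q (- x) n * qpoch q (s * x) n * qpoch q (- s * x) n) \<longlonglongrightarrow>
      qpoch_inf q x * qpoch_inf q (- x) * qpoch_inf q (s * x) * qpoch_inf q (- s * x)"
    by (intro tendsto_intros qpoch_LIMSEQ)
  ultimately show ?thesis
    using LIMSEQ_unique by auto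
qed

end

section \<open>The Askey--Wilson integral\<close>

lemma integral_circle_radius:
  fixes f :: "complex \<Rightarrow> complex"
  assumes f: "f holomorphic_on S" and S: "open S" "0 \<notin> S"
    and sub: "\<And>z. \<rho>1 \<le> norm z \<Longrightarrow> norm z \<le> \<rho>2 \<Longrightarrow> z \<in> S"
    and \<rho>: "0 < \<rho>1" "\<rho>1 \<le> \<rho>2"
  shows "integral {-pi..pi} (\<lambda>\<theta>. f (of_real \<rho>1 * cis \<theta>)) = integral {-pi..pi} (\<lambda>\<theta>. f (of_real \<rho>2 * cis \<theta>))"
proof -
  let ?p = "\<lambda>\<rho>. part_circlepath 0 \<rho> (-pi) pi"
  have pm: "- pi < pi"
    using pi_gt_zero by linarith
  have eq: "contour_integral (?p \<rho>) (\<lambda>z. f z / z) = \<i> * integral {-pi..pi} (\<lambda>\<theta>. f (of_real \<rho> * cis \<theta>))"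
    if "\<rho> > 0" for \<rho>
  proof -
    have "contour_integral (?p \<rho>) (\<lambda>z. f z / z) = integral {-pi..pi} (\<lambda>\<theta>. \<i> * f (of_real \<rho> * cis \<theta>))"
      unfolding contour_integral_part_circlepath_eq[OF pm]
      using that by (intro integral_cong) simp
    then show ?thesis
      by simp
  qed
  have "contour_integral (?p \<rho>1) (\<lambda>z. f z / z) = contour_integral (?p \<rho>2) (\<lambda>z. f z / z)"
  proof (rule Cauchy_theorem_homotopic_loops[OF _ S(1)])
    show "homotopic_loops S (?p \<rho>1) (?p \<rho>2)"
    proof (rule homotopic_loops_linear)
      fix t :: real
      show "closed_segment (?p \<rho>1 t) (?p \<rho>2 t) \<subseteq> S"
      proof
        fix z assume "z \<in> closed_segment (?p \<rho>1 t) (?p \<rho>2 t)"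
        then obtain u where u: "0 \<le> u" "u \<le> 1"
          and z: "z = (1 - u) *\<^sub>R ?p \<rho>1 t + u *\<^sub>R ?p \<rho>2 t"
          by (auto simp: closed_segment_def)
        define w where "w = cis (linepath (-pi) pi t)"
        have "z = of_real ((1 - u) * \<rho>1 + u * \<rho>2) * w"
          by (simp add: z part_circlepath_def w_def cis_conv_exp scaleR_conv_of_real algebra_simps)
        then have "norm z = \<bar>(1 - u) * \<rho>1 + u * \<rho>2\<bar>"
          by (simp add: norm_mult w_def del: of_real_add of_real_mult)
        also have "\<dots> = \<rho>1 + u * (\<rho>2 - \<rho>1)"
          using mult_nonneg_nonneg[of u "\<rho>2 - \<rho>1"] u \<rho> by (simp add: algebra_simps)
        finally have n: "norm z = \<rho>1 + u * (\<rho>2 - \<rho>1)" .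
        moreover have "u * (\<rho>2 - \<rho>1) \<le> 1 * (\<rho>2 - \<rho>1)"
          using u \<rho> by (intro mult_right_mono) auto
        ultimately show "z \<in> S"
          using u \<rho> by (intro sub) auto
      qed
      have "exp (\<i> * of_real (- pi)) = exp (\<i> * of_real pi)"
        by (simp add: exp_minus)
      then show "pathfinish (?p \<rho>1) = pathstart (?p \<rho>1)" "pathfinish (?p \<rho>2) = pathstart (?p \<rho>2)"
        by simp_all
    qed auto
    show "(\<lambda>z. f z / z) holomorphic_on S"
      using S f by (intro holomorphic_intros) auto
  qed auto
  then show ?thesis
    using eq \<rho> by simp
qed

definition qpair :: "real \<Rightarrow> complex \<Rightarrow> complex \<Rightarrow> complex" where
  "qpair q a z = qpoch_inf q (a * z) * qpoch_inf q (a / z)"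

lemma h_prod_simps: "h_prod q [] \<theta> = 1" "h_prod q (a # as) \<theta> = qpair q a (cis \<theta>) * h_prod q as \<theta>"
  by (simp_all add: h_prod_def qpair_def cis_conv_exp divide_inverse exp_minus)

lemma aw_weight_eq:
  "aw_weight q a b c d \<theta> = qpoch_inf q ((cis \<theta>)\<^sup>2) * qpoch_inf q (1 / (cis \<theta>)\<^sup>2) /
    (qpair q a (cis \<theta>) * qpair q b (cis \<theta>) * qpair q c (cis \<theta>) * qpair q d (cis \<theta>))"
proof -
  have "exp (2 * \<i> * of_real \<theta>) = (cis \<theta>)\<^sup>2"
    by (simp add: cis_conv_exp mult_ac flip: exp_double)
  moreover have "exp (- 2 * \<i> * of_real \<theta>) = 1 / (cis \<theta>)\<^sup>2"
    using calculation by (simp add: exp_minus field_simps)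
  ultimately show ?thesis
    by (simp add: aw_weight_def qpair_def divide_inverse exp_minus mult_ac flip: cis_conv_exp)
qed

lemma aw_weight_perm:
  "aw_weight q a b c d = aw_weight q b a c d"
  "aw_weight q a b c d = aw_weight q c b a d"
  "aw_weight q a b c d = aw_weight q d b c a"
  by (auto simp: aw_weight_eq mult_ac fun_eq_iff)

context
  fixes q :: real
  assumes q: "0 < q" "q < 1"
begin

lemma qpair_nz: "norm a < 1 \<Longrightarrow> norm z = 1 \<Longrightarrow> qpair q a z \<noteq> 0"
  by (simp add: qpair_def qpoch_inf_nz[OF q] norm_mult norm_divide)

lemma qpair_shift:
  "qpair q a z = qpoch q (a * z) n * qpoch q (a / z) n * qpair q (a * of_real q ^ n) z"
  unfolding qpair_def
  by (subst (1 2) qpoch_inf_shift[OF q, of _ n]) (simp add: mult_ac)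

lemma continuous_on_qpair [continuous_intros]:
  "continuous_on S f \<Longrightarrow> continuous_on S g \<Longrightarrow> (\<And>x. x \<in> S \<Longrightarrow> g x \<noteq> 0) \<Longrightarrow>
    continuous_on S (\<lambda>x. qpair q (f x) (g x))"
  unfolding qpair_def by (intro continuous_intros q) auto

lemma continuous_on_aw_weight_gen:
  assumes "continuous_on S a" "continuous_on S b" "continuous_on S c" "continuous_on S d" "continuous_on S \<theta>"
    and "\<And>x. x \<in> S \<Longrightarrow> norm (a x) < 1" "\<And>x. x \<in> S \<Longrightarrow> norm (b x) < 1"
    and "\<And>x. x \<in> S \<Longrightarrow> norm (c x) < 1" "\<And>x. x \<in> S \<Longrightarrow> norm (d x) < 1"
  shows "continuous_on S (\<lambda>x. aw_weight q (a x) (b x) (c x) (d x) (\<theta> x))"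
  unfolding aw_weight_eq using assms
  by (intro continuous_intros q) (auto simp: qpair_nz)

lemma continuous_on_aw_weight:
  assumes "norm a < 1" "norm b < 1" "norm c < 1" "norm d < 1"
  shows "continuous_on S (aw_weight q a b c d)"
  using assms continuous_on_aw_weight_gen[of S "\<lambda>_. a" "\<lambda>_. b" "\<lambda>_. c" "\<lambda>_. d" "\<lambda>x. x"]
  by simp

lemma aw_weight_shift:
  assumes "norm a < 1"
  shows "aw_weight q (a * of_real q ^ n) b c d \<theta> =
    aw_weight q a b c d \<theta> * (qpoch q (a * cis \<theta>) n * qpoch q (a / cis \<theta>) n)"
proof -
  have "qpoch q (a * cis \<theta>) n \<noteq> 0" "qpoch q (a / cis \<theta>) n \<noteq> 0"
    using assms by (auto intro!: qpoch_nz[OF q] simp: norm_mult norm_divide)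
  then show ?thesis
    by (simp add: aw_weight_eq qpair_shift[of a _ n])
qed

lemma first_moment_identity:
  fixes z :: complex
  assumes "z \<noteq> 0"
  shows "z * (1 - z\<^sup>2) * ((1 - a / z) * (1 - b / z) * (1 - c / z) * (1 - d / z)) +
    (1 / z) * (1 - 1 / z\<^sup>2) * ((1 - a * z) * (1 - b * z) * (1 - c * z) * (1 - d * z)) =
    (1 - z\<^sup>2) * (1 - 1 / z\<^sup>2) * ((1 - a * b * c * d) * (z + 1 / z) -
      (a + b + c + d - (a * b * c + a * b * d + a * c * d + b * c * d)))"
proof -
  define y where "y = 1 / z"
  have "z * y = 1"
    using assms by (simp add: y_def)
  then have "z * (1 - z\<^sup>2) * ((1 - a * y) * (1 - b * y) * (1 - c * y) * (1 - d * y)) +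
    y * (1 - y\<^sup>2) * ((1 - a * z) * (1 - b * z) * (1 - c * z) * (1 - d * z)) =
    (1 - z\<^sup>2) * (1 - y\<^sup>2) * ((1 - a * b * c * d) * (z + y) -
      (a + b + c + d - (a * b * c + a * b * d + a * c * d + b * c * d)))"
    by algebra
  then show ?thesis
    by (simp add: y_def power_divide)
qed

text \<open>
  The function \<open>G\<close> below satisfies \<open>G (q z) = - G (1 / z)\<close>. As the mean of \<open>G\<close> over the circles
  of radius \<open>q\<close> and \<open>1\<close> is the same, this mean is zero.
\<close>

lemma aw_weight_first_moment:
  assumes n: "norm a < 1" "norm b < 1" "norm c < 1" "norm d < 1"
  shows "integral {0..pi} (\<lambda>\<theta>. aw_weight q a b c d \<theta> * ((1 - a * b * c * d) * of_real (2 * cos \<theta>) -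
      (a + b + c + d - (a * b * c + a * b * d + a * c * d + b * c * d)))) = 0"
proof -
  define D where "D = (\<lambda>t z. qpoch_inf q (t * z) * qpoch_inf q (t * of_real q / z))"
  define G where "G = (\<lambda>z. z * (qpoch_inf q (z\<^sup>2) * qpoch_inf q (of_real q / z\<^sup>2)) / (D a z * D b z * D c z * D d z))"
  define S where "S = {z. z \<noteq> 0} \<inter> (\<Inter>t\<in>{a,b,c,d}. {z. norm (t * z) < 1 \<and> norm (t * of_real q) < norm z})"
  have D_nz: "D t z \<noteq> 0" if "norm (t * z) < 1" "norm (t * of_real q) < norm z" for t z
    using that unfolding D_def
    by (simp, intro conjI qpoch_inf_nz q) (auto simp: norm_divide norm_mult divide_less_eq split: if_splits)
  have inS: "z \<in> S" if z: "q \<le> norm z" "norm z \<le> 1" for z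
  proof -
    have "norm (t * z) < 1 \<and> norm (t * of_real q) < norm z" if t: "norm t < 1" for t
    proof
      show "norm (t * z) < 1"
        using t z q by (auto simp: norm_mult intro: le_less_trans[OF mult_left_le])
      have "norm t * q < 1 * q"
        using t q by (intro mult_strict_right_mono) auto
      then have "norm t * q < norm z"
        using z by linarith
      then show "norm (t * of_real q) < norm z"
        using q by (simp add: norm_mult)
    qed
    moreover have "z \<noteq> 0"
      using z q by auto
    ultimately show ?thesis
      using n unfolding S_def by blast
  qed
  have "open S"
    unfolding S_def
    by (intro open_Int open_INT ballI finite.intros open_Collect_conj open_Collect_neq open_Collect_less
      continuous_intros)
  have D_hol: "D t holomorphic_on S" for t
    unfolding D_def by (intro holomorphic_intros holomorphic_on_qpoch_inf[OF q]) (auto simp: S_def)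
  have D_nz_S: "D t z \<noteq> 0" if "z \<in> S" "t \<in> {a, b, c, d}" for t z
    using that by (intro D_nz) (auto simp: S_def)
  have S_nz: "z \<noteq> 0" if "z \<in> S" for z
    using that by (simp add: S_def)
  have hol: "G holomorphic_on S"
    unfolding G_def
    by (intro holomorphic_intros holomorphic_on_qpoch_inf[OF q] D_hol)
      (simp_all add: D_nz_S S_nz)
  have anti: "G (of_real q * z) = - G (1 / z)" if "z \<noteq> 0" for z
  proof -
    have D: "D t (of_real q * z) = D t (1 / z)" for t
      using q by (simp add: D_def mult_ac)
    have 1: "qpoch_inf q (of_real q / (1 / z)\<^sup>2) = (1 - of_real q * z\<^sup>2) * qpoch_inf q ((of_real q * z)\<^sup>2)"
      using qpoch_inf_step[OF q, of "of_real q * z\<^sup>2"] that by (simp add: field_simps power2_eq_square)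
    have 2: "qpoch_inf q (of_real q / (of_real q * z)\<^sup>2) = (1 - 1 / (of_real q * z\<^sup>2)) * qpoch_inf q ((1 / z)\<^sup>2)"
      using qpoch_inf_step[OF q, of "1 / (of_real q * z\<^sup>2)"] that q by (simp add: field_simps power2_eq_square)
    have 3: "of_real q * z * (1 - 1 / (of_real q * z\<^sup>2)) = - ((1 / z) * (1 - of_real q * z\<^sup>2))"
      using that q by (simp add: field_simps power2_eq_square)
    have "x * (U * (k * V)) / d = - (y * (V * (m * U)) / d)" if "x * k = - (y * m)" for x k y m U V d :: complex
    proof -
      have "x * (U * (k * V)) = (x * k) * (U * V)"
        by simp
      then show ?thesis
        unfolding that by simp
    qed
    from this[OF 3] show ?thesis
      unfolding G_def D 1 2 .
  qed
  have cont: "continuous_on T (\<lambda>\<theta>. G (cis \<theta>))" for T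
  proof -
    have "continuous_on S G"
      using hol by (rule holomorphic_on_imp_continuous_on)
    then show ?thesis
      by (rule continuous_on_compose2) (auto intro!: continuous_intros inS simp: q less_imp_le)
  qed
  then have int: "(\<lambda>\<theta>. G (cis \<theta>)) integrable_on {x..y}" for x y
    by (intro integrable_continuous_real)
  have int': "(\<lambda>\<theta>. G (cis (- \<theta>))) integrable_on {x..y}" for x y
    by (intro integrable_continuous_real continuous_on_compose2[OF cont[of UNIV], of _ uminus] continuous_intros) auto
  have "integral {-pi..pi} (\<lambda>\<theta>. G (of_real 1 * cis \<theta>)) = integral {-pi..pi} (\<lambda>\<theta>. G (of_real q * cis \<theta>))"
    using q by (intro integral_circle_radius[OF hol \<open>open S\<close>, symmetric] inS) (auto simp: S_def)
  also have "\<dots> = integral {-pi..pi} (\<lambda>\<theta>. - G (cis (- \<theta>)))"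
    by (intro integral_cong) (simp add: anti divide_inverse)
  also have "\<dots> = - integral {-pi..pi} (\<lambda>\<theta>. G (cis \<theta>))"
    using Henstock_Kurzweil_Integration.integral_reflect_real[where f = "\<lambda>\<theta>. G (cis \<theta>)" and a = "-pi" and b = pi] by simp
  finally have zero: "integral {-pi..pi} (\<lambda>\<theta>. G (cis \<theta>)) = 0"
    by simp
  have "integral {-pi..0} (\<lambda>\<theta>. G (cis \<theta>)) = integral {0..pi} (\<lambda>\<theta>. G (cis (- \<theta>)))"
    using Henstock_Kurzweil_Integration.integral_reflect_real[where f = "\<lambda>\<theta>. G (cis \<theta>)" and a = "-pi" and b = 0] by simp
  moreover have "integral {-pi..0} (\<lambda>\<theta>. G (cis \<theta>)) + integral {0..pi} (\<lambda>\<theta>. G (cis \<theta>)) = 0"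
    using zero Henstock_Kurzweil_Integration.integral_combine[of "-pi" 0 pi "\<lambda>\<theta>. G (cis \<theta>)"] int by simp
  ultimately have "integral {0..pi} (\<lambda>\<theta>. G (cis \<theta>) + G (cis (- \<theta>))) = 0"
    using int int' by (subst integral_add) (auto simp: add.commute)
  moreover have "G (cis \<theta>) + G (cis (- \<theta>)) = aw_weight q a b c d \<theta> * ((1 - a * b * c * d) * of_real (2 * cos \<theta>) -
      (a + b + c + d - (a * b * c + a * b * d + a * c * d + b * c * d)))" for \<theta>
  proof -
    define z where "z = cis \<theta>"
    have z: "z \<noteq> 0" "norm z = 1" "cis (- \<theta>) = 1 / z"
      by (auto simp: z_def divide_inverse)
    have X: "of_real (2 * cos \<theta>) = z + 1 / z"
      by (simp add: z_def complex_eq_iff divide_inverse)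
    define E where "E = (\<lambda>t. qpoch_inf q (t * of_real q * z) * qpoch_inf q (t * of_real q / z))"
    define N where "N = qpoch_inf q (of_real q * z\<^sup>2) * qpoch_inf q (of_real q / z\<^sup>2)"
    have nz: "1 - t * z \<noteq> 0" "1 - t / z \<noteq> 0" if "norm t < 1" for t
      using that z(2) by (metis norm_mult norm_divide mult.right_neutral div_by_1 norm_one right_minus_eq less_irrefl)+
    have Enz: "E t \<noteq> 0" if "norm t < 1" for t
      using that z norm_mult_q_power_less[OF q that, of 1]
      by (auto simp: E_def norm_mult norm_divide intro!: qpoch_inf_nz[OF q])
    have D1: "D t z = (1 - t * z) * E t" for t
      by (simp add: D_def E_def qpoch_inf_step[OF q, of "t * z"] mult_ac)
    have D2: "D t (1 / z) = (1 - t / z) * E t" for t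
      by (simp add: D_def E_def qpoch_inf_step[OF q, of "t / z"] mult_ac)
    have P: "qpair q t z = (1 - t * z) * (1 - t / z) * E t" for t
      using qpoch_inf_step[OF q, of "t * z"] qpoch_inf_step[OF q, of "t / z"]
      by (simp add: qpair_def E_def mult_ac)
    have N1: "qpoch_inf q (z\<^sup>2) * qpoch_inf q (of_real q / z\<^sup>2) = (1 - z\<^sup>2) * N"
      using qpoch_inf_step[OF q, of "z\<^sup>2"] by (simp add: N_def mult_ac)
    have N2: "qpoch_inf q ((1 / z)\<^sup>2) * qpoch_inf q (of_real q / (1 / z)\<^sup>2) = (1 - 1 / z\<^sup>2) * N"
      using qpoch_inf_step[OF q, of "1 / z\<^sup>2"] by (simp add: N_def mult_ac power_divide)
    have N3: "qpoch_inf q (z\<^sup>2) * qpoch_inf q (1 / z\<^sup>2) = (1 - z\<^sup>2) * (1 - 1 / z\<^sup>2) * N"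
      using qpoch_inf_step[OF q, of "z\<^sup>2"] qpoch_inf_step[OF q, of "1 / z\<^sup>2"]
      by (simp add: N_def mult_ac)
    define A where "A = (1 - a * z) * (1 - b * z) * (1 - c * z) * (1 - d * z)"
    define B where "B = (1 - a / z) * (1 - b / z) * (1 - c / z) * (1 - d / z)"
    define F where "F = E a * E b * E c * E d"
    have nzs: "A \<noteq> 0" "B \<noteq> 0" "F \<noteq> 0"
      using nz n Enz by (auto simp: A_def B_def F_def)
    have "G z = z * ((1 - z\<^sup>2) * N) / (A * F)"
      by (simp add: G_def D1 N1 A_def F_def mult_ac)
    moreover have "G (1 / z) = (1 / z) * ((1 - 1 / z\<^sup>2) * N) / (B * F)"
      unfolding G_def D2 N2 by (simp add: B_def F_def mult_ac)
    moreover have "aw_weight q a b c d \<theta> = (1 - z\<^sup>2) * (1 - 1 / z\<^sup>2) * N / (A * B * F)"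
      unfolding aw_weight_eq by (simp add: N3 P A_def B_def F_def mult_ac flip: z_def)
    moreover have "z * ((1 - z\<^sup>2) * N) / (A * F) + (1 / z) * ((1 - 1 / z\<^sup>2) * N) / (B * F) =
        (z * (1 - z\<^sup>2) * B + (1 / z) * (1 - 1 / z\<^sup>2) * A) * N / (A * B * F)"
      using nzs z by (simp add: field_simps)
    ultimately show ?thesis
      using first_moment_identity[OF z(1), of a b c d] unfolding X z(3) by (simp add: A_def B_def flip: z_def)
  qed
  ultimately show ?thesis
    by simp
qed

end

lemma norm_mult_less_1: "norm x < 1 \<Longrightarrow> norm y < 1 \<Longrightarrow> norm (x * y) < 1" for x y :: complex
  using norm_mult_less[of x 1 y 1] by simp

context
  fixes q :: real
  assumes q: "0 < q" "q < 1"
begin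

lemma qpoch_1_cis: "qpoch q (a * cis \<theta>) 1 * qpoch q (a / cis \<theta>) 1 = 1 + a\<^sup>2 - a * of_real (2 * cos \<theta>)"
proof -
  have "of_real (2 * cos \<theta>) = cis \<theta> + 1 / cis \<theta>"
    by (simp add: complex_eq_iff divide_inverse)
  then show ?thesis
    by (simp add: qpoch_Suc field_simps power2_eq_square)
qed

lemma aw_integral_contiguous:
  assumes n: "norm a < 1" "norm b < 1" "norm c < 1" "norm d < 1"
  shows "(1 - a * b * c * d) * integral {0..pi} (aw_weight q (a * of_real q) b c d) =
    (1 - a * b) * (1 - a * c) * (1 - a * d) * integral {0..pi} (aw_weight q a b c d)"
proof -
  let ?w = "aw_weight q a b c d"
  let ?e = "a + b + c + d - (a * b * c + a * b * d + a * c * d + b * c * d)"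
  have cont: "continuous_on {0..pi} ?w"
    using n by (rule continuous_on_aw_weight[OF q])
  have "(1 - a * b * c * d) * integral {0..pi} (aw_weight q (a * of_real q) b c d) =
      integral {0..pi} (\<lambda>\<theta>. (1 - a * b * c * d) * aw_weight q (a * of_real q) b c d \<theta>)"
    by simp
  also have "\<dots> = integral {0..pi} (\<lambda>\<theta>. ((1 - a * b * c * d) * (1 + a\<^sup>2) - a * ?e) * ?w \<theta> -
      a * (?w \<theta> * ((1 - a * b * c * d) * of_real (2 * cos \<theta>) - ?e)))"
  proof (rule integral_cong)
    fix \<theta> :: real
    have "aw_weight q (a * of_real q) b c d \<theta> = ?w \<theta> * (1 + a\<^sup>2 - a * of_real (2 * cos \<theta>))"
      using aw_weight_shift[OF q n(1), of 1 b c d \<theta>] unfolding qpoch_1_cis by simp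
    then show "(1 - a * b * c * d) * aw_weight q (a * of_real q) b c d \<theta> =
        ((1 - a * b * c * d) * (1 + a\<^sup>2) - a * ?e) * ?w \<theta> -
        a * (?w \<theta> * ((1 - a * b * c * d) * of_real (2 * cos \<theta>) - ?e))"
      by algebra
  qed
  also have "\<dots> = ((1 - a * b * c * d) * (1 + a\<^sup>2) - a * ?e) * integral {0..pi} ?w -
      a * integral {0..pi} (\<lambda>\<theta>. ?w \<theta> * ((1 - a * b * c * d) * of_real (2 * cos \<theta>) - ?e))"
    by (subst integral_diff)
      (auto intro!: integrable_continuous_real continuous_intros cont)
  also have "integral {0..pi} (\<lambda>\<theta>. ?w \<theta> * ((1 - a * b * c * d) * of_real (2 * cos \<theta>) - ?e)) = 0"
    by (rule aw_weight_first_moment[OF q n])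
  also have "(1 - a * b * c * d) * (1 + a\<^sup>2) - a * ?e = (1 - a * b) * (1 - a * c) * (1 - a * d)"
    by algebra
  finally show ?thesis
    by simp
qed

lemma aw_integral_reduce:
  assumes n: "norm a < 1" "norm b < 1" "norm c < 1" "norm d < 1"
  shows "qpoch_inf q (a * b * c * d) * integral {0..pi} (aw_weight q 0 b c d) =
    qpoch_inf q (a * b) * qpoch_inf q (a * c) * qpoch_inf q (a * d) * integral {0..pi} (aw_weight q a b c d)"
proof -
  define I where "I = (\<lambda>a. integral {0..pi} (aw_weight q a b c d))"
  have it: "qpoch q (a * b * c * d) k * I (a * of_real q ^ k) =
      qpoch q (a * b) k * qpoch q (a * c) k * qpoch q (a * d) k * I a" for k
  proof (induction k)
    case (Suc k)
    define A where "A = a * of_real q ^ k"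
    have "norm A < 1"
      unfolding A_def by (rule norm_mult_q_power_less[OF q n(1)])
    have S: "qpoch q (a * y) (Suc k) = qpoch q (a * y) k * (1 - A * y)" for y
      by (simp add: qpoch_Suc A_def mult_ac)
    from aw_integral_contiguous[OF \<open>norm A < 1\<close> n(2,3,4)]
    have "(1 - A * b * c * d) * I (a * of_real q ^ Suc k) = (1 - A * b) * (1 - A * c) * (1 - A * d) * I A"
      by (simp add: I_def A_def mult_ac)
    moreover have "qpoch q (a * b * c * d) k * I A =
        qpoch q (a * b) k * qpoch q (a * c) k * qpoch q (a * d) k * I a"
      using Suc by (simp add: A_def)
    moreover have S4: "qpoch q (a * b * c * d) (Suc k) = qpoch q (a * b * c * d) k * (1 - A * b * c * d)"
      by (simp add: qpoch_Suc A_def mult_ac)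
    ultimately show ?case
      unfolding S S4 by algebra
  qed simp
  have "continuous_on (ball 0 1) I"
    unfolding I_def
    using n by (intro integral_continuous_on_param[of _ 0 pi, simplified]) 
      (auto simp: case_prod_unfold intro!: continuous_on_aw_weight_gen[OF q] continuous_intros)
  moreover have "(\<lambda>k. a * of_real q ^ k) \<longlonglongrightarrow> 0"
    using tendsto_mult_right_zero[OF tendsto_q_power[OF q]] by simp
  ultimately have "(\<lambda>k. I (a * of_real q ^ k)) \<longlonglongrightarrow> I 0"
    by (rule continuous_on_tendsto_compose)
      (auto intro!: always_eventually norm_mult_q_power_less[OF q n(1)])
  then have "(\<lambda>k. qpoch q (a * b * c * d) k * I (a * of_real q ^ k)) \<longlonglongrightarrow> qpoch_inf q (a * b * c * d) * I 0"
    by (intro tendsto_intros qpoch_LIMSEQ q)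
  moreover have "(\<lambda>k. qpoch q (a * b) k * qpoch q (a * c) k * qpoch q (a * d) k * I a) \<longlonglongrightarrow>
      qpoch_inf q (a * b) * qpoch_inf q (a * c) * qpoch_inf q (a * d) * I a"
    by (intro tendsto_intros qpoch_LIMSEQ q)
  ultimately have "qpoch_inf q (a * b * c * d) * I 0 = qpoch_inf q (a * b) * qpoch_inf q (a * c) * qpoch_inf q (a * d) * I a"
    unfolding it by (rule LIMSEQ_unique)
  then show ?thesis
    unfolding I_def .
qed

lemma aw_integral_up_to_constant:
  assumes n: "norm a < 1" "norm b < 1" "norm c < 1" "norm d < 1"
  shows "qpoch_inf q (a * b * c * d) * integral {0..pi} (aw_weight q 0 0 0 0) =
    qpoch_inf q (a * b) * qpoch_inf q (a * c) * qpoch_inf q (a * d) * qpoch_inf q (b * c) *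
    qpoch_inf q (b * d) * qpoch_inf q (c * d) * integral {0..pi} (aw_weight q a b c d)"
proof -
  note qpoch_inf_0[OF q, simp]
  have 1: "integral {0..pi} (aw_weight q 0 0 c d) =
      qpoch_inf q (b * c) * qpoch_inf q (b * d) * integral {0..pi} (aw_weight q 0 b c d)"
    using aw_integral_reduce[OF n(2) _ n(3,4), of 0] by (simp add: aw_weight_perm(1)[of q b 0])
  have 2: "integral {0..pi} (aw_weight q 0 0 0 d) = qpoch_inf q (c * d) * integral {0..pi} (aw_weight q 0 0 c d)"
    using aw_integral_reduce[OF n(3) _ _ n(4), of 0 0] by (simp add: aw_weight_perm(2)[of q c 0 0])
  have 3: "integral {0..pi} (aw_weight q 0 0 0 0) = integral {0..pi} (aw_weight q 0 0 0 d)"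
    using aw_integral_reduce[OF n(4), of 0 0 0] by (simp add: aw_weight_perm(3)[of q d 0 0 0])
  show ?thesis
    using aw_integral_reduce[OF n] unfolding 1 2 3 by (simp add: mult_ac)
qed

text \<open>For the parameters \<open>\<plusminus>\<surd>q, \<plusminus>q\<close> the weight is \<open>(1 - e\<^sup>2\<^sup>i\<^sup>\<theta>) (1 - e\<^sup>-\<^sup>2\<^sup>i\<^sup>\<theta>)\<close>, which gives the constant.\<close>

lemma aw_integral_0: "integral {0..pi} (aw_weight q 0 0 0 0) = 2 * of_real pi / qpoch_inf q (of_real q)"
proof -
  define s where "s = complex_of_real (sqrt q)"
  define Q where "Q = complex_of_real q"
  have s2: "s\<^sup>2 = Q"
    using q by (simp add: s_def Q_def flip: of_real_power)
  have ns: "norm s < 1" "norm Q < 1"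
    using q by (auto simp: s_def Q_def)
  note sq = qpoch_inf_square[OF q s2[unfolded Q_def]]
  note nz = qpoch_inf_nz[OF q]
  have w: "aw_weight q s (-s) Q (-Q) \<theta> = of_real (2 - 2 * cos (2 * \<theta>))" for \<theta>
  proof -
    define z where "z = cis \<theta>"
    have z: "z \<noteq> 0" "norm z = 1"
      by (auto simp: z_def)
    have 1: "qpoch_inf q (Q * z\<^sup>2) = qpoch_inf q (s * z) * qpoch_inf q (- (s * z)) * qpoch_inf q (Q * z) * qpoch_inf q (- (Q * z))"
      using sq[of "s * z"] by (simp add: power_mult_distrib s2 flip: power2_eq_square mult.assoc)
    have 2: "qpoch_inf q (Q / z\<^sup>2) = qpoch_inf q (s / z) * qpoch_inf q (- (s / z)) * qpoch_inf q (Q / z) * qpoch_inf q (- (Q / z))"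
      using sq[of "s / z"] by (simp add: power_divide s2 flip: power2_eq_square)
    have 3: "qpoch_inf q (z\<^sup>2) * qpoch_inf q (1 / z\<^sup>2) =
        (1 - z\<^sup>2) * (1 - 1 / z\<^sup>2) * (qpoch_inf q (Q * z\<^sup>2) * qpoch_inf q (Q / z\<^sup>2))"
      using qpoch_inf_step[OF q, of "z\<^sup>2"] qpoch_inf_step[OF q, of "1 / z\<^sup>2"] by (simp add: Q_def mult_ac)
    have nzs: "qpoch_inf q (s * z) \<noteq> 0" "qpoch_inf q (- (s * z)) \<noteq> 0" "qpoch_inf q (Q * z) \<noteq> 0"
      "qpoch_inf q (- (Q * z)) \<noteq> 0" "qpoch_inf q (s / z) \<noteq> 0" "qpoch_inf q (- (s / z)) \<noteq> 0"
      "qpoch_inf q (Q / z) \<noteq> 0" "qpoch_inf q (- (Q / z)) \<noteq> 0"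
      using z ns by (auto intro!: nz simp: norm_mult norm_divide)
    have "aw_weight q s (-s) Q (-Q) \<theta> = (1 - z\<^sup>2) * (1 - 1 / z\<^sup>2)"
      using nzs unfolding aw_weight_eq z_def[symmetric] 3 1 2 by (simp add: qpair_def)
    also have "\<dots> = 2 - (z\<^sup>2 + 1 / z\<^sup>2)"
      using z by (simp add: field_simps)
    also have "z\<^sup>2 = cis (2 * \<theta>)"
      by (simp add: z_def power2_eq_square cis_mult)
    also have "2 - (cis (2 * \<theta>) + 1 / cis (2 * \<theta>)) = of_real (2 - 2 * cos (2 * \<theta>))"
      by (simp add: complex_eq_iff divide_inverse)
    finally show ?thesis .
  qed
  have "((\<lambda>\<theta>. 2 - 2 * cos (2 * \<theta>)) has_integral (2 * pi - sin (2 * pi)) - (2 * 0 - sin (2 * 0))) {0..pi}"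
    by (rule fundamental_theorem_of_calculus)
      (auto intro!: derivative_eq_intros simp flip: has_real_derivative_iff_has_vector_derivative)
  then have "(complex_of_real \<circ> (\<lambda>\<theta>. 2 - 2 * cos (2 * \<theta>)) has_integral complex_of_real (2 * pi)) {0..pi}"
    by (intro has_integral_linear bounded_linear_of_real) simp
  then have I: "integral {0..pi} (aw_weight q s (-s) Q (-Q)) = 2 * of_real pi"
    unfolding w[abs_def] by (simp add: o_def integral_unique)
  have Qn: "qpoch_inf q (Q * Q) \<noteq> 0" "qpoch_inf q (- Q) \<noteq> 0" "qpoch_inf q Q \<noteq> 0"
    "qpoch_inf q (s * Q) \<noteq> 0" "qpoch_inf q (- (s * Q)) \<noteq> 0" "qpoch_inf q s \<noteq> 0" "qpoch_inf q (- s) \<noteq> 0"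
    "qpoch_inf q (Q * Q * Q) \<noteq> 0" "qpoch_inf q (- (Q * Q)) \<noteq> 0"
    using ns by (auto intro!: nz norm_mult_less_1)
  have 1: "qpoch_inf q s * qpoch_inf q (- s) * qpoch_inf q (- Q) = 1"
    using sq[of s] Qn by (simp add: s2 mult.assoc flip: power2_eq_square)
  have 2: "qpoch_inf q s = (1 - s) * qpoch_inf q (s * Q)" "qpoch_inf q (- s) = (1 + s) * qpoch_inf q (- (s * Q))"
    "qpoch_inf q (- Q) = (1 + Q) * qpoch_inf q (- (Q * Q))" 
    "qpoch_inf q Q = (1 - Q) * (1 - Q * Q) * qpoch_inf q (Q * Q * Q)"
    using qpoch_inf_step[OF q, of s] qpoch_inf_step[OF q, of "-s"] qpoch_inf_step[OF q, of "-Q"]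
      qpoch_inf_step[OF q, of Q] qpoch_inf_step[OF q, of "Q * Q"]
    by (simp_all add: Q_def)
  have ss: "(1 - s) * (1 + s) = 1 - Q"
    by (simp add: algebra_simps flip: s2 power2_eq_square)
  have "qpoch_inf q (s * (-s) * Q * (-Q)) * integral {0..pi} (aw_weight q 0 0 0 0) =
    qpoch_inf q (s * (-s)) * qpoch_inf q (s * Q) * qpoch_inf q (s * (-Q)) * qpoch_inf q ((-s) * Q) *
    qpoch_inf q ((-s) * (-Q)) * qpoch_inf q (Q * (-Q)) * integral {0..pi} (aw_weight q s (-s) Q (-Q))"
    using ns by (intro aw_integral_up_to_constant) auto
  then have 3: "qpoch_inf q (Q * Q * Q) * integral {0..pi} (aw_weight q 0 0 0 0) =
    qpoch_inf q (-Q) * (qpoch_inf q (s * Q) * qpoch_inf q (- (s * Q)))\<^sup>2 * qpoch_inf q (- (Q * Q)) * (2 * of_real pi)"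
    unfolding I using s2 by (simp add: power2_eq_square mult_ac)
  define X where "X = qpoch_inf q (s * Q) * qpoch_inf q (- (s * Q))"
  have X: "(1 - Q) * X * qpoch_inf q (- Q) = 1"
    using 1 unfolding 2(1,2) X_def ss[symmetric] by (simp add: mult_ac)
  have "qpoch_inf q Q * integral {0..pi} (aw_weight q 0 0 0 0) =
      (1 - Q) * (1 - Q * Q) * (qpoch_inf q (Q * Q * Q) * integral {0..pi} (aw_weight q 0 0 0 0))"
    unfolding 2(4) by simp
  also have "\<dots> = ((1 - Q) * X * qpoch_inf q (- Q)) * ((1 - Q) * X * ((1 + Q) * qpoch_inf q (- (Q * Q)))) * (2 * of_real pi)"
    unfolding 3 X_def[symmetric] by algebra
  also have "\<dots> = 2 * of_real pi"
    unfolding 2(3)[symmetric] X by simp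
  finally show ?thesis
    using Qn(3) unfolding Q_def by (simp add: field_simps)
qed

theorem aw_integral:
  assumes n: "norm a < 1" "norm b < 1" "norm c < 1" "norm d < 1"
  shows "integral {0..pi} (aw_weight q a b c d) = 2 * of_real pi * qpoch_inf q (a * b * c * d) /
    (qpoch_inf q (of_real q) * qpoch_inf q (a * b) * qpoch_inf q (a * c) * qpoch_inf q (a * d) *
     qpoch_inf q (b * c) * qpoch_inf q (b * d) * qpoch_inf q (c * d))"
proof -
  have "qpoch_inf q (of_real q) \<noteq> 0"
    using q by (intro qpoch_inf_nz) auto
  moreover have "qpoch_inf q (a * b) \<noteq> 0" "qpoch_inf q (a * c) \<noteq> 0" "qpoch_inf q (a * d) \<noteq> 0"
    "qpoch_inf q (b * c) \<noteq> 0" "qpoch_inf q (b * d) \<noteq> 0" "qpoch_inf q (c * d) \<noteq> 0"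
    using n by (auto intro!: qpoch_inf_nz[OF q] norm_mult_less_1)
  ultimately show ?thesis
    using aw_integral_up_to_constant[OF n] unfolding aw_integral_0 by (simp add: field_simps)
qed

end

section \<open>The three-term recurrence\<close>

text \<open>
  The coefficient of \<open>(a z, a / z; q)\<^sub>k\<close> in the series for \<open>p\<^sub>n\<close> is \<open>aw_num q T (q ^ n) k * aw_den q a b c d k\<close>
  with \<open>T = a b c d\<close>.
\<close>

definition aw_num :: "real \<Rightarrow> complex \<Rightarrow> complex \<Rightarrow> nat \<Rightarrow> complex" where
  "aw_num q T Q k = qpoch q (1 / Q) k * qpoch q (T * Q / of_real q) k"

definition aw_den :: "real \<Rightarrow> complex \<Rightarrow> complex \<Rightarrow> complex \<Rightarrow> complex \<Rightarrow> nat \<Rightarrow> complex" where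
  "aw_den q a b c d k = of_real q ^ k / (qpoch q (of_real q) k * qpoch q (a * b) k * qpoch q (a * c) k * qpoch q (a * d) k)"

definition aw_basis :: "real \<Rightarrow> complex \<Rightarrow> complex \<Rightarrow> nat \<Rightarrow> complex" where
  "aw_basis q a z k = qpoch q (a * z) k * qpoch q (a / z) k"

definition aw_sum :: "real \<Rightarrow> complex \<Rightarrow> complex \<Rightarrow> complex \<Rightarrow> complex \<Rightarrow> complex \<Rightarrow> complex \<Rightarrow> nat \<Rightarrow> complex" where
  "aw_sum q a b c d z Q N = (\<Sum>k\<le>N. aw_num q (a * b * c * d) Q k * aw_den q a b c d k * aw_basis q a z k)"

definition aw_up :: "real \<Rightarrow> complex \<Rightarrow> complex \<Rightarrow> complex \<Rightarrow> complex \<Rightarrow> complex \<Rightarrow> complex" where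
  "aw_up q a b c d Q = (1 - a * b * Q) * (1 - a * c * Q) * (1 - a * d * Q) * (1 - a * b * c * d * Q / of_real q) /
    (a * (1 - a * b * c * d * Q\<^sup>2 / of_real q) * (1 - a * b * c * d * Q\<^sup>2))"

definition aw_down :: "real \<Rightarrow> complex \<Rightarrow> complex \<Rightarrow> complex \<Rightarrow> complex \<Rightarrow> complex \<Rightarrow> complex" where
  "aw_down q a b c d Q = a * (1 - Q) * (1 - b * c * Q / of_real q) * (1 - b * d * Q / of_real q) * (1 - c * d * Q / of_real q) /
    ((1 - a * b * c * d * Q\<^sup>2 / (of_real q)\<^sup>2) * (1 - a * b * c * d * Q\<^sup>2 / of_real q))"

lemma aw_basis_Suc:
  assumes "z \<noteq> 0"
  shows "aw_basis q a z (Suc k) = aw_basis q a z k * (1 + a\<^sup>2 * of_real q ^ (2 * k) - a * of_real q ^ k * (z + 1 / z))"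
proof -
  have "(1 - a * z * P) * (1 - a / z * P) = 1 + a\<^sup>2 * P\<^sup>2 - a * P * (z + 1 / z)" for P
    using assms by (simp add: field_simps power2_eq_square)
  from this[of "of_real q ^ k"] show ?thesis
    by (simp add: aw_basis_def qpoch_Suc mult_ac flip: power_even_eq)
qed

context
  fixes q :: real
  assumes q: "0 < q" "q < 1"
begin

lemma aw_num_diff:
  assumes "Q \<noteq> 0"
  shows "aw_num q T (Q * of_real q) (Suc j) - aw_num q T Q (Suc j) =
    - (1 - of_real q ^ Suc j) * (1 - T * Q\<^sup>2) / (Q * of_real q) * qpoch q (1 / Q) j * qpoch q (T * Q) j"
proof -
  have 1: "qpoch q (1 / (Q * of_real q)) (Suc j) = (1 - 1 / (Q * of_real q)) * qpoch q (1 / Q) j"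
    using q by (subst qpoch_Suc_left) simp
  have 2: "qpoch q (T * Q / of_real q) (Suc j) = (1 - T * Q / of_real q) * qpoch q (T * Q) j"
    using q by (subst qpoch_Suc_left) simp
  have 3: "qpoch q (T * (Q * of_real q) / of_real q) (Suc j) = qpoch q (T * Q) j * (1 - T * Q * of_real q ^ j)"
    using q by (simp add: qpoch_Suc)
  have 4: "(1 - 1 / (Q * of_real q)) * (1 - T * Q * of_real q ^ j) - (1 - 1 / Q * of_real q ^ j) * (1 - T * Q / of_real q) =
      - (1 - of_real q ^ Suc j) * (1 - T * Q\<^sup>2) / (Q * of_real q)"
    using assms q by (simp add: field_simps power2_eq_square)
  have "aw_num q T (Q * of_real q) (Suc j) - aw_num q T Q (Suc j) =
      ((1 - 1 / (Q * of_real q)) * (1 - T * Q * of_real q ^ j) - (1 - 1 / Q * of_real q ^ j) * (1 - T * Q / of_real q)) *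
      qpoch q (1 / Q) j * qpoch q (T * Q) j"
    unfolding aw_num_def 1 2 3 qpoch_Suc[of q "1 / Q"] by (simp add: algebra_simps)
  then show ?thesis
    unfolding 4 .
qed

lemma aw_recurrence_rational_identity:
  fixes Q K p :: complex
  assumes "a \<noteq> 0" "Q \<noteq> 0" "K \<noteq> 0" "p \<noteq> 0" "1 - a * b * c * d * Q\<^sup>2 / p \<noteq> 0"
  shows "- ((1 - a * b * Q) * (1 - a * c * Q) * (1 - a * d * Q) * (1 - a * b * c * d * Q * K / p) /
      (a * (1 - a * b * c * d * Q\<^sup>2 / p) * (Q * p))) -
    a * (1 - b * c * Q / p) * (1 - b * d * Q / p) * (1 - c * d * Q / p) * (1 - K / Q) / (1 - a * b * c * d * Q\<^sup>2 / p) =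
    (1 - a\<^sup>2 * (p * K)) / (a * (p * K)) * (1 - K / Q) * (1 - a * b * c * d * Q * K / p) -
    (1 - a * b * K) * (1 - a * c * K) * (1 - a * d * K) / (p * (a * K))"
proof -
  define R where "R = 1 - a * b * c * d * Q\<^sup>2 / p"
  define N1 where "N1 = (1 - a * b * Q) * (1 - a * c * Q) * (1 - a * d * Q)"
  define N2 where "N2 = (p - b * c * Q) * (p - b * d * Q) * (p - c * d * Q)"
  define N3 where "N3 = (1 - a * b * K) * (1 - a * c * K) * (1 - a * d * K)"
  define W where "W = p - a * b * c * d * Q * K"
  have R: "R \<noteq> 0" "p * R = p - a * b * c * d * Q\<^sup>2"
    using assms by (auto simp: R_def field_simps)
  have e2: "(1 - b * c * Q / p) * (1 - b * d * Q / p) * (1 - c * d * Q / p) = N2 / p ^ 3"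
    using assms by (simp add: N2_def field_simps power3_eq_cube)
  have e4: "1 - a * b * c * d * Q * K / p = W / p"
    using assms by (simp add: W_def field_simps)
  have e5: "1 - K / Q = (Q - K) / Q"
    using assms by (simp add: field_simps)
  have key: "- (N1 * K * W * p) - a\<^sup>2 * K * N2 * (Q - K) =
     (1 - a\<^sup>2 * (p * K)) * (Q - K) * W * (p * R) - N3 * Q * p * (p * R)"
    unfolding R N1_def N2_def N3_def W_def by algebra
  define D where "D = a * R * Q * K * p ^ 3"
  have t: "N1 * (W / p) / (a * R * (Q * p)) = N1 * K * W * p / D"
    "a * (N2 / p ^ 3) * ((Q - K) / Q) / R = a\<^sup>2 * K * N2 * (Q - K) / D"
    "(1 - a\<^sup>2 * (p * K)) / (a * (p * K)) * ((Q - K) / Q) * (W / p) = (1 - a\<^sup>2 * (p * K)) * (Q - K) * W * (p * R) / D"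
    "N3 / (p * (a * K)) = N3 * Q * p * (p * R) / D"
    using assms R(1) by (simp_all add: D_def power2_eq_square power3_eq_cube mult_ac)
  have "- (N1 * (W / p) / (a * R * (Q * p))) - a * (N2 / p ^ 3) * ((Q - K) / Q) / R =
      (- (N1 * K * W * p) - a\<^sup>2 * K * N2 * (Q - K)) / D"
    unfolding t by (simp add: diff_divide_distrib)
  also have "\<dots> = (1 - a\<^sup>2 * (p * K)) / (a * (p * K)) * ((Q - K) / Q) * (W / p) - N3 / (p * (a * K))"
    unfolding key t by (simp add: diff_divide_distrib)
  finally show ?thesis
    unfolding e2[symmetric] e4[symmetric] e5[symmetric] N1_def N3_def R_def by (simp add: mult.assoc)
qed

lemma aw_num_recurrence:
  assumes "a \<noteq> 0" "Q \<noteq> 0"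
    and T: "T = a * b * c * d" "1 - T * Q\<^sup>2 \<noteq> 0" "1 - T * Q\<^sup>2 / of_real q \<noteq> 0" "1 - T * Q\<^sup>2 / (of_real q)\<^sup>2 \<noteq> 0"
  shows "aw_up q a b c d Q * (aw_num q T (Q * of_real q) (Suc j) - aw_num q T Q (Suc j)) +
      aw_down q a b c d Q * (aw_num q T (Q / of_real q) (Suc j) - aw_num q T Q (Suc j)) =
    (1 - of_real q ^ Suc j) * ((1 - a\<^sup>2 * of_real q ^ Suc j) / (a * of_real q ^ Suc j) * aw_num q T Q (Suc j) -
      (1 - a * b * of_real q ^ j) * (1 - a * c * of_real q ^ j) * (1 - a * d * of_real q ^ j) /
        (of_real q * (a * of_real q ^ j)) * aw_num q T Q j)"
proof -
  define p where "p = complex_of_real q"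
  define K where "K = p ^ j"
  have p: "p \<noteq> 0" "K \<noteq> 0"
    using q by (auto simp: p_def K_def)
  define E where "E = aw_num q T Q j"
  have up: "(1 - T * Q / p) * qpoch q (T * Q) j = qpoch q (T * Q / p) j * (1 - T * Q * K / p)"
    using qpoch_Suc_left[of q "T * Q / p" j] qpoch_Suc[of q "T * Q / p" j] p by (simp add: p_def K_def)
  have down: "(1 - 1 / Q) * qpoch q (p / Q) j = qpoch q (1 / Q) j * (1 - K / Q)"
    using qpoch_Suc_left[of q "1 / Q" j] qpoch_Suc[of q "1 / Q" j] by (simp add: p_def K_def)
  have S: "aw_num q T Q (Suc j) = E * (1 - K / Q) * (1 - T * Q * K / p)"
    by (simp add: aw_num_def E_def qpoch_Suc p_def K_def)
  define N1 where "N1 = (1 - a * b * Q) * (1 - a * c * Q) * (1 - a * d * Q)"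
  define N2 where "N2 = (1 - b * c * Q / p) * (1 - b * d * Q / p) * (1 - c * d * Q / p)"
  define k where "k = 1 - p ^ Suc j"
  define R where "R = 1 - T * Q\<^sup>2 / p"
  have "aw_up q a b c d Q * (aw_num q T (Q * p) (Suc j) - aw_num q T Q (Suc j)) =
      N1 * (1 - T * Q / p) / (a * R * (1 - T * Q\<^sup>2)) * (- k * (1 - T * Q\<^sup>2) / (Q * p) * qpoch q (1 / Q) j * qpoch q (T * Q) j)"
    using aw_num_diff[OF \<open>Q \<noteq> 0\<close>, of T j] by (simp add: aw_up_def N1_def R_def p_def k_def T(1))
  also have "\<dots> = - (k * N1 / (a * R * (Q * p))) * qpoch q (1 / Q) j * ((1 - T * Q / p) * qpoch q (T * Q) j)"
    using T(2) by (simp add: mult_ac)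
  also have "\<dots> = k * E * - (N1 * (1 - T * Q * K / p) / (a * R * (Q * p)))"
    unfolding up by (simp add: E_def aw_num_def p_def mult_ac)
  finally have 1: "aw_up q a b c d Q * (aw_num q T (Q * p) (Suc j) - aw_num q T Q (Suc j)) = \<dots>" .
  have D: "aw_num q T Q (Suc j) - aw_num q T (Q / p) (Suc j) =
      - k * (1 - T * Q\<^sup>2 / p\<^sup>2) / Q * qpoch q (p / Q) j * qpoch q (T * Q / p) j"
    using aw_num_diff[of "Q / p" T j] p assms(2) by (simp add: p_def k_def power_divide)
  define x where "x = 1 - 1 / Q"
  define M where "M = 1 - T * Q\<^sup>2 / p\<^sup>2"
  have M: "M \<noteq> 0"
    using T(4) by (simp add: M_def p_def)
  have "aw_down q a b c d Q * (aw_num q T (Q / p) (Suc j) - aw_num q T Q (Suc j)) =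
      - (aw_down q a b c d Q * (aw_num q T Q (Suc j) - aw_num q T (Q / p) (Suc j)))"
    by (simp add: algebra_simps)
  also have "\<dots> = a * (1 - Q) * N2 / (M * R) * (k * M / Q * qpoch q (p / Q) j * qpoch q (T * Q / p) j)"
    unfolding D by (simp add: aw_down_def N2_def R_def M_def p_def T(1) mult.assoc)
  also have "\<dots> = a * ((1 - Q) / Q) * N2 / R * k * qpoch q (p / Q) j * qpoch q (T * Q / p) j"
    using M by (simp add: mult_ac)
  also have "(1 - Q) / Q = - (1 - 1 / Q)"
    using assms(2) by (simp add: field_simps)
  also have "a * - (1 - 1 / Q) * N2 / R * k * qpoch q (p / Q) j * qpoch q (T * Q / p) j =
      - (a * N2 / R * k * ((1 - 1 / Q) * qpoch q (p / Q) j) * qpoch q (T * Q / p) j)"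
    unfolding x_def[symmetric] by (simp add: mult_ac)
  also have "\<dots> = k * E * - (a * N2 * (1 - K / Q) / R)"
    unfolding down by (simp add: E_def aw_num_def p_def mult_ac)
  finally have 2: "aw_down q a b c d Q * (aw_num q T (Q / p) (Suc j) - aw_num q T Q (Suc j)) = \<dots>" .
  have "- (N1 * (1 - T * Q * K / p) / (a * R * (Q * p))) - a * N2 * (1 - K / Q) / R =
     (1 - a\<^sup>2 * (p * K)) / (a * (p * K)) * (1 - K / Q) * (1 - T * Q * K / p) -
     (1 - a * b * K) * (1 - a * c * K) * (1 - a * d * K) / (p * (a * K))"
    using aw_recurrence_rational_identity[of a Q K p b c d] assms(1,2) p T(1,3)
    by (simp add: N1_def N2_def R_def p_def mult.assoc)
  moreover have "k * E * - x1 + k * E * - x2 = k * (y * (E * u * v) - w * E)" if "- x1 - x2 = y * u * v - w" for x1 x2 y u v w :: complex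
    using that by algebra
  moreover have "p ^ Suc j = p * K"
    by (simp add: K_def)
  ultimately show ?thesis
    unfolding p_def[symmetric] unfolding 1 2 unfolding S K_def[symmetric] E_def[symmetric] k_def[symmetric]
    by (simp only:)
qed

lemma aw_den_Suc:
  assumes "norm a < 1" "norm b < 1" "norm c < 1" "norm d < 1"
  shows "aw_den q a b c d (Suc k) * ((1 - of_real q ^ Suc k) * ((1 - a * b * of_real q ^ k) *
    (1 - a * c * of_real q ^ k) * (1 - a * d * of_real q ^ k))) = of_real q * aw_den q a b c d k"
proof -
  have "norm (complex_of_real q) < 1"
    using q by simp
  then have nz: "1 - of_real q * of_real q ^ k \<noteq> (0 :: complex)" "1 - a * b * of_real q ^ k \<noteq> 0" "1 - a * c * of_real q ^ k \<noteq> 0"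
    "1 - a * d * of_real q ^ k \<noteq> 0"
    using assms by (auto intro!: one_minus_q_power_nz[OF q] norm_mult_less_1 simp del: right_minus_eq)
  have "p * P / (A1 * x1 * (A2 * x2) * (A3 * x3) * (A4 * x4)) * (x1 * (x2 * x3 * x4)) = p * (P / (A1 * A2 * A3 * A4))"
    if "x1 \<noteq> 0" "x2 \<noteq> 0" "x3 \<noteq> 0" "x4 \<noteq> 0" for p P A1 A2 A3 A4 x1 x2 x3 x4 :: complex
    using that by simp
  from this[OF nz] show ?thesis
    unfolding aw_den_def qpoch_Suc power_Suc .
qed

lemma aw_sum_recurrence:
  assumes "a \<noteq> 0" "z \<noteq> 0" "Q \<noteq> 0" and T: "T = a * b * c * d"
    and n: "norm a < 1" "norm b < 1" "norm c < 1" "norm d < 1"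
    and nz: "1 - T * Q\<^sup>2 \<noteq> 0" "1 - T * Q\<^sup>2 / of_real q \<noteq> 0" "1 - T * Q\<^sup>2 / (of_real q)\<^sup>2 \<noteq> 0"
  shows "aw_up q a b c d Q * (aw_sum q a b c d z (Q * of_real q) N - aw_sum q a b c d z Q N) +
      aw_down q a b c d Q * (aw_sum q a b c d z (Q / of_real q) N - aw_sum q a b c d z Q N) -
      (z + 1 / z - a - 1 / a) * aw_sum q a b c d z Q N =
    aw_num q T Q N * aw_den q a b c d N * aw_basis q a z (Suc N) / (a * of_real q ^ N)"
proof (induction N)
  case 0
  show ?case
    using assms by (simp add: aw_sum_def aw_num_def aw_den_def aw_basis_Suc[OF \<open>z \<noteq> 0\<close>])
      (simp add: aw_basis_def field_simps power2_eq_square)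
next
  case (Suc N)
  define p where "p = complex_of_real q"
  define K where "K = p ^ N"
  define X where "X = z + 1 / z"
  have K: "K \<noteq> 0" "p \<noteq> 0"
    using q by (auto simp: K_def p_def)
  define U where "U = aw_up q a b c d Q"
  define V where "V = aw_down q a b c d Q"
  define n0 where "n0 = aw_num q T Q N"
  define n1 where "n1 = aw_num q T Q (Suc N)"
  define n2 where "n2 = aw_num q T (Q * p) (Suc N)"
  define n3 where "n3 = aw_num q T (Q / p) (Suc N)"
  define d0 where "d0 = aw_den q a b c d N"
  define d1 where "d1 = aw_den q a b c d (Suc N)"
  define B where "B = aw_basis q a z (Suc N)"
  define \<pi> where "\<pi> = (1 - a * b * K) * (1 - a * c * K) * (1 - a * d * K)"
  have num: "U * (n2 - n1) + V * (n3 - n1) = (1 - p * K) * ((1 - a\<^sup>2 * (p * K)) / (a * (p * K)) * n1 - \<pi> / (p * (a * K)) * n0)"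
    using aw_num_recurrence[OF assms(1,3) T nz, of N]
    by (simp add: U_def V_def n0_def n1_def n2_def n3_def \<pi>_def p_def K_def)
  have den: "d1 * ((1 - p * K) * \<pi>) = p * d0"
    using aw_den_Suc[OF n, of N] by (simp add: d0_def d1_def \<pi>_def p_def K_def)
  have "p ^ (2 * Suc N) = (p * K)\<^sup>2" "p ^ Suc N = p * K"
    unfolding K_def by (simp_all only: power_even_eq power_Suc)
  then have bas: "aw_basis q a z (Suc (Suc N)) = B * (1 + a\<^sup>2 * (p * K)\<^sup>2 - a * (p * K) * X)"
    using aw_basis_Suc[OF \<open>z \<noteq> 0\<close>, of q a "Suc N"] unfolding p_def[symmetric] B_def X_def by simp
  define s1 where "s1 = aw_sum q a b c d z Q N"
  define s2 where "s2 = aw_sum q a b c d z (Q * p) N"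
  define s3 where "s3 = aw_sum q a b c d z (Q / p) N"
  have IH: "U * (s2 - s1) + V * (s3 - s1) - (X - a - 1 / a) * s1 = n0 * d0 * B / (a * K)"
    using Suc by (simp add: U_def V_def s1_def s2_def s3_def X_def n0_def d0_def B_def K_def p_def)
  have r: "(1 - p * K) * ((1 - a\<^sup>2 * (p * K)) / (a * (p * K))) - (X - a - 1 / a) =
      (1 + a\<^sup>2 * (p * K)\<^sup>2 - a * (p * K) * X) / (a * (p * K))"
    using K assms(1) by (simp add: field_simps power2_eq_square)
  have "d1 * B * ((1 - p * K) * (\<pi> / (p * (a * K)) * n0)) = (d1 * ((1 - p * K) * \<pi>)) * B * n0 / (p * (a * K))"
    by simp
  also have "\<dots> = n0 * d0 * B / (a * K)"
    unfolding den using K by (simp add: mult_ac)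
  finally have z: "d1 * B * ((1 - p * K) * (\<pi> / (p * (a * K)) * n0)) = n0 * d0 * B / (a * K)" .
  have "U * ((s2 + n2 * d1 * B) - (s1 + n1 * d1 * B)) + V * ((s3 + n3 * d1 * B) - (s1 + n1 * d1 * B)) -
      (X - a - 1 / a) * (s1 + n1 * d1 * B) =
      (U * (s2 - s1) + V * (s3 - s1) - (X - a - 1 / a) * s1) + d1 * B * (U * (n2 - n1) + V * (n3 - n1)) -
      (X - a - 1 / a) * (n1 * d1 * B)"
    by (simp add: algebra_simps)
  also have "\<dots> = n1 * d1 * B * ((1 - p * K) * ((1 - a\<^sup>2 * (p * K)) / (a * (p * K))) - (X - a - 1 / a))"
    unfolding IH num right_diff_distrib[of "1 - p * K"] right_diff_distrib[of "d1 * B"] z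
    by (simp add: algebra_simps)
  also have "\<dots> = n1 * d1 * (B * (1 + a\<^sup>2 * (p * K)\<^sup>2 - a * (p * K) * X)) / (a * (p * K))"
    unfolding r by simp
  finally show ?case
    unfolding bas[symmetric]
    by (simp add: U_def V_def s1_def s2_def s3_def X_def n1_def n2_def n3_def d1_def B_def K_def p_def T aw_sum_def)
qed

end

definition aw_alpha :: "real \<Rightarrow> complex \<Rightarrow> nat \<Rightarrow> complex" where
  "aw_alpha q T n = (case n of 0 \<Rightarrow> 1 / (1 - T) | Suc m \<Rightarrow>
     (1 - T * of_real q ^ m) / ((1 - T * of_real q ^ (2 * m + 1)) * (1 - T * of_real q ^ (2 * m + 2))))"

definition aw_beta :: "real \<Rightarrow> complex \<Rightarrow> complex \<Rightarrow> complex \<Rightarrow> complex \<Rightarrow> nat \<Rightarrow> complex" where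
  "aw_beta q a b c d n = (case n of
     0 \<Rightarrow> a + 1 / a - (1 - a * b) * (1 - a * c) * (1 - a * d) / (a * (1 - a * b * c * d))
   | Suc m \<Rightarrow> a + 1 / a - aw_up q a b c d (of_real q ^ n) - aw_down q a b c d (of_real q ^ n))"

definition aw_gamma :: "real \<Rightarrow> complex \<Rightarrow> complex \<Rightarrow> complex \<Rightarrow> complex \<Rightarrow> nat \<Rightarrow> complex" where
  "aw_gamma q a b c d m = (1 - of_real q ^ Suc m) *
     ((1 - a * b * of_real q ^ m) * (1 - a * c * of_real q ^ m) * (1 - a * d * of_real q ^ m) *
      ((1 - b * c * of_real q ^ m) * (1 - b * d * of_real q ^ m) * (1 - c * d * of_real q ^ m))) /
     ((1 - a * b * c * d * of_real q ^ (2 * m)) * (1 - a * b * c * d * of_real q ^ (2 * m + 1)))"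

context
  fixes q :: real
  assumes q: "0 < q" "q < 1"
begin

lemma aw_num_eq_0: "n < k \<Longrightarrow> aw_num q T (of_real q ^ n) k = 0"
  using q by (auto simp: aw_num_def qpoch_def intro!: bexI[of _ n])

lemma aw_poly_eq_aw_sum:
  assumes "a \<noteq> 0" "n \<le> N"
  shows "aw_poly q n a b c d \<theta> =
    qpoch q (a * b) n * qpoch q (a * c) n * qpoch q (a * d) n / a ^ n * aw_sum q a b c d (cis \<theta>) (of_real q ^ n) N"
proof -
  define T where "T = a * b * c * d"
  have T: "of_real q powi (int n - 1) * a * b * c * d = T * of_real q ^ n / of_real q"
    using q by (simp add: T_def power_int_diff)
  have p: "of_real q powi (- int n) = 1 / complex_of_real q ^ n" "a powi (- int n) = 1 / a ^ n"
    by (simp_all add: power_int_minus divide_inverse)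
  let ?f = "\<lambda>k. aw_num q T (of_real q ^ n) k * aw_den q a b c d k * aw_basis q a (cis \<theta>) k"
  have "qpochs q [of_real q powi - int n, of_real q powi (int n - 1) * a * b * c * d,
          a * exp (\<i> * of_real \<theta>), a * exp (- \<i> * of_real \<theta>)] k /
        qpochs q [of_real q, a * b, a * c, a * d] k * of_real q ^ k = ?f k" for k
    unfolding T p by (simp add: aw_num_def aw_den_def aw_basis_def exp_minus divide_inverse mult_ac flip: cis_conv_exp)
  then have "qhyper q [of_real q powi - int n, of_real q powi (int n - 1) * a * b * c * d,
      a * exp (\<i> * of_real \<theta>), a * exp (- \<i> * of_real \<theta>)] [a * b, a * c, a * d] (of_real q) = (\<Sum>k. ?f k)"
    unfolding qhyper_def by simp
  also have "\<dots> = (\<Sum>k\<le>N. ?f k)"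
    using assms(2) by (intro suminf_finite) (auto simp: aw_num_eq_0)
  finally show ?thesis
    unfolding aw_poly_def p by (simp add: aw_sum_def T_def)
qed

context
  fixes a b c d T :: complex
  assumes n: "a \<noteq> 0" "norm a < 1" "norm b < 1" "norm c < 1" "norm d < 1"
    and T: "T = a * b * c * d"
begin

lemma norm_T: "norm T < 1"
  unfolding T using n by (intro norm_mult_less_1)

lemma T_nz: "1 - T * of_real q ^ m \<noteq> 0" "1 - T \<noteq> 0"
  using one_minus_q_power_nz[OF q norm_T, of m] one_minus_q_power_nz[OF q norm_T, of 0] by auto

lemma aw_alpha_nz: "aw_alpha q T m \<noteq> 0"
  using T_nz(1)[of "m - 1"] T_nz(1)[of "2 * (m - 1) + 1"] T_nz(1)[of "2 * (m - 1) + 2"] T_nz(2)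
  by (cases m) (simp_all add: aw_alpha_def del: right_minus_eq)

lemma aw_poly_0: "aw_poly q 0 a b c d \<theta> = 1"
  using n by (simp add: aw_poly_eq_aw_sum[of a 0 0] aw_sum_def aw_num_def aw_den_def aw_basis_def)

lemma aw_poly_recurrence_0:
  "of_real (2 * cos \<theta>) * aw_poly q 0 a b c d \<theta> =
    aw_alpha q T 0 * aw_poly q 1 a b c d \<theta> + aw_beta q a b c d 0 * aw_poly q 0 a b c d \<theta>"
proof -
  define P where "P = (1 - a * b) * (1 - a * c) * (1 - a * d)"
  define X where "X = complex_of_real (2 * cos \<theta>)"
  define p where "p = complex_of_real q"
  have X: "X = cis \<theta> + 1 / cis \<theta>"
    by (simp add: X_def complex_eq_iff divide_inverse)
  have p: "p \<noteq> 0" "1 - p \<noteq> 0"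
    using q by (auto simp: p_def)
  have "1 - a * b \<noteq> 0" "1 - a * c \<noteq> 0" "1 - a * d \<noteq> 0"
    using n norm_mult_less_1[of a] by fastforce+
  then have P: "P \<noteq> 0"
    by (simp add: P_def)
  have "aw_sum q a b c d (cis \<theta>) p 1 = 1 + (1 - 1 / p) * (1 - T) * (p / ((1 - p) * P)) * (1 + a\<^sup>2 - a * X)"
    using p aw_basis_Suc[of "cis \<theta>" q a 0]
    by (simp add: aw_sum_def aw_num_def aw_den_def qpoch_Suc T P_def p_def X mult.assoc) 
      (simp add: aw_basis_def qpoch_Suc)
  also have "(1 - 1 / p) * (1 - T) * (p / ((1 - p) * P)) = - (1 - T) / P"
  proof -
    have "1 - 1 / p = - (1 - p) / p"
      using p by (simp add: field_simps)
    moreover have "- x / p * t * (p / (x * P)) = - t / P" if "x \<noteq> 0" for x t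
      using that p(1) by simp
    from this[OF p(2), of "1 - T"] show ?thesis
      unfolding calculation .
  qed
  finally have S: "aw_sum q a b c d (cis \<theta>) p 1 = 1 + - (1 - T) / P * (1 + a\<^sup>2 - a * X)" .
  have "aw_poly q 1 a b c d \<theta> = P / a * aw_sum q a b c d (cis \<theta>) p 1"
    using aw_poly_eq_aw_sum[OF n(1), of 1 1 b c d \<theta>] by (simp add: qpoch_Suc P_def p_def)
  also have "\<dots> = (P - (1 - T) * (1 + a\<^sup>2 - a * X)) / a"
    unfolding S using P n(1) by (simp add: field_simps)
  finally have 1: "aw_poly q 1 a b c d \<theta> = (P - (1 - T) * (1 + a\<^sup>2 - a * X)) / a" .
  have "X = 1 / (1 - T) * ((P - (1 - T) * (1 + a\<^sup>2 - a * X)) / a) + (a + 1 / a - P / (a * (1 - T)))"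
    using T_nz(2) n(1) by (simp add: divide_simps power2_eq_square del: right_minus_eq) algebra
  then show ?thesis
    unfolding aw_poly_0 1 X_def[symmetric] by (simp add: aw_alpha_def aw_beta_def P_def T)
qed

lemma aw_poly_recurrence:
  "of_real (2 * cos \<theta>) * aw_poly q (Suc m) a b c d \<theta> =
    aw_alpha q T (Suc m) * aw_poly q (Suc (Suc m)) a b c d \<theta> +
    aw_beta q a b c d (Suc m) * aw_poly q (Suc m) a b c d \<theta> + aw_gamma q a b c d m * aw_poly q m a b c d \<theta>"
proof -
  define p where "p = complex_of_real q"
  define Q where "Q = p ^ Suc m"
  define N where "N = Suc (Suc m)"
  define X where "X = complex_of_real (2 * cos \<theta>)"
  have X: "X = cis \<theta> + 1 / cis \<theta>"
    by (simp add: X_def complex_eq_iff divide_inverse)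
  have p: "p \<noteq> 0"
    using q by (auto simp: p_def)
  define S where "S = (\<lambda>Q. aw_sum q a b c d (cis \<theta>) Q N)"
  define G where "G = (\<lambda>k. qpoch q (a * b) k * qpoch q (a * c) k * qpoch q (a * d) k / a ^ k)"
  have pol: "aw_poly q k a b c d \<theta> = G k * S (p ^ k)" if "k \<le> N" for k
    using aw_poly_eq_aw_sum[OF n(1) that] by (simp add: G_def S_def p_def)
  have e: "T * Q\<^sup>2 = T * p ^ (2 * m + 2)" "T * Q\<^sup>2 / p = T * p ^ (2 * m + 1)" "T * Q\<^sup>2 / p\<^sup>2 = T * p ^ (2 * m)"
    "Q / p = p ^ m" "Q * p = p ^ Suc (Suc m)" "Q \<noteq> 0"
    using p by (simp_all add: Q_def power2_eq_square power_add mult_2)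
  have "aw_num q T Q N = 0"
    unfolding Q_def p_def by (rule aw_num_eq_0) (simp add: N_def)
  moreover have "1 - T * Q\<^sup>2 \<noteq> 0" "1 - T * Q\<^sup>2 / p \<noteq> 0" "1 - T * Q\<^sup>2 / p\<^sup>2 \<noteq> 0"
    unfolding e(2,3) unfolding e(1) using T_nz(1) by (simp_all only: p_def not_False_eq_True)
  ultimately have rec: "aw_up q a b c d Q * (S (Q * p) - S Q) + aw_down q a b c d Q * (S (Q / p) - S Q) - (X - a - 1 / a) * S Q = 0"
    using aw_sum_recurrence[OF q n(1) _ \<open>Q \<noteq> 0\<close> T n(2-5), of "cis \<theta>" N]
    unfolding S_def p_def[symmetric] X by (simp add: diff_diff_eq del: right_minus_eq)
  have ez: "a * b * Q = a * b * p ^ Suc m" "b * c * Q / p = b * c * p ^ m" "b * d * Q / p = b * d * p ^ m"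
     "c * d * Q / p = c * d * p ^ m" "T * Q / p = T * p ^ m"
    using p by (simp_all add: Q_def)
  have G_up: "G (Suc k) * a = G k * ((1 - a * b * p ^ k) * (1 - a * c * p ^ k) * (1 - a * d * p ^ k))" for k
    using n(1) by (simp add: G_def qpoch_Suc p_def)
  have nz: "1 - T * p ^ k \<noteq> 0" for k
    using T_nz(1) by (simp add: p_def)
  have up: "G (Suc m) * aw_up q a b c d Q = aw_alpha q T (Suc m) * G N"
  proof -
    have "aw_up q a b c d Q * a = (1 - a * b * p ^ Suc m) * (1 - a * c * p ^ Suc m) * (1 - a * d * p ^ Suc m) * aw_alpha q T (Suc m)"
      using n(1) unfolding aw_up_def aw_alpha_def T[symmetric] p_def[symmetric] e(1,2) ez(5) Q_def[symmetric] by simp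
    then have "G (Suc m) * aw_up q a b c d Q * a = aw_alpha q T (Suc m) * (G N * a)"
      unfolding N_def G_up by simp
    then show ?thesis
      using n(1) by simp
  qed
  have down: "G (Suc m) * aw_down q a b c d Q = aw_gamma q a b c d m * G m"
  proof -
    have "aw_down q a b c d Q = a * ((1 - p ^ Suc m) * (1 - b * c * p ^ m) * (1 - b * d * p ^ m) * (1 - c * d * p ^ m) /
      ((1 - T * p ^ (2 * m)) * (1 - T * p ^ (2 * m + 1))))"
      unfolding aw_down_def T[symmetric] p_def[symmetric] e(2,3) ez unfolding Q_def by simp
    then have "G (Suc m) * aw_down q a b c d Q = (G (Suc m) * a) * ((1 - p ^ Suc m) * (1 - b * c * p ^ m) * (1 - b * d * p ^ m) * (1 - c * d * p ^ m) /
      ((1 - T * p ^ (2 * m)) * (1 - T * p ^ (2 * m + 1))))"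
      by simp
    also have "\<dots> = aw_gamma q a b c d m * G m"
      unfolding G_up aw_gamma_def T[symmetric] p_def[symmetric] by simp
    finally show ?thesis .
  qed
  have be: "aw_beta q a b c d (Suc m) = a + 1 / a - aw_up q a b c d Q - aw_down q a b c d Q"
    by (simp add: aw_beta_def Q_def p_def)
  have "X * (G (Suc m) * S Q) = (G (Suc m) * aw_up q a b c d Q) * S (Q * p) +
      aw_beta q a b c d (Suc m) * (G (Suc m) * S Q) + (G (Suc m) * aw_down q a b c d Q) * S (Q / p)"
    using rec unfolding be by algebra
  then show ?thesis
    unfolding up down e(4,5) X_def using pol[of m] pol[of "Suc m"] pol[of N] by (simp add: N_def Q_def mult.assoc)
qed

lemma aw_alpha_tendsto: "aw_alpha q T \<longlonglongrightarrow> 1"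
proof -
  have p: "(\<lambda>m. of_real q ^ (2 * m + j) :: complex) \<longlonglongrightarrow> 0" for j
    using LIMSEQ_subseq_LIMSEQ[OF tendsto_q_power[OF q], of "\<lambda>m. 2 * m + j"] by (simp add: strict_mono_def o_def)
  have "(\<lambda>m. (1 - T * u m) / ((1 - T * v m) * (1 - T * w m))) \<longlonglongrightarrow> (1 - T * 0) / ((1 - T * 0) * (1 - T * 0))"
    if "u \<longlonglongrightarrow> 0" "v \<longlonglongrightarrow> 0" "w \<longlonglongrightarrow> 0" for u v w :: "nat \<Rightarrow> complex"
    by (intro tendsto_intros that) auto
  from this[OF tendsto_q_power[OF q] p[of 1] p[of 2]] have "(\<lambda>m. aw_alpha q T (Suc m)) \<longlonglongrightarrow> 1"
    by (simp add: aw_alpha_def)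
  then show ?thesis
    by (rule LIMSEQ_imp_Suc)
qed

lemma aw_gamma_tendsto: "aw_gamma q a b c d \<longlonglongrightarrow> 1"
proof -
  have p: "(\<lambda>m. of_real q ^ (2 * m + j) :: complex) \<longlonglongrightarrow> 0" for j
    using LIMSEQ_subseq_LIMSEQ[OF tendsto_q_power[OF q], of "\<lambda>m. 2 * m + j"] by (simp add: strict_mono_def o_def)
  have s: "(\<lambda>m. of_real q ^ Suc m :: complex) \<longlonglongrightarrow> 0"
    using tendsto_q_power[OF q] by (rule LIMSEQ_Suc)
  have "(\<lambda>m. (1 - u m) *
     ((1 - a * b * v m) * (1 - a * c * v m) * (1 - a * d * v m) *
      ((1 - b * c * v m) * (1 - b * d * v m) * (1 - c * d * v m))) /
     ((1 - a * b * c * d * w m) * (1 - a * b * c * d * y m))) \<longlonglongrightarrow> (1 - 0) *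
     ((1 - a * b * 0) * (1 - a * c * 0) * (1 - a * d * 0) *
      ((1 - b * c * 0) * (1 - b * d * 0) * (1 - c * d * 0))) /
     ((1 - a * b * c * d * 0) * (1 - a * b * c * d * 0))"
    if "u \<longlonglongrightarrow> 0" "v \<longlonglongrightarrow> 0" "w \<longlonglongrightarrow> 0" "y \<longlonglongrightarrow> 0" for u v w y :: "nat \<Rightarrow> complex"
    by (intro tendsto_intros that) auto
  from this[OF s tendsto_q_power[OF q] p[of 0, simplified] p[of 1]] show ?thesis
    unfolding aw_gamma_def[abs_def] by simp
qed

lemma aw_beta_tendsto: "aw_beta q a b c d \<longlonglongrightarrow> 0"
proof -
  have Q: "(\<lambda>m. of_real q ^ Suc m :: complex) \<longlonglongrightarrow> 0"
    using tendsto_q_power[OF q] by (rule LIMSEQ_Suc)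
  have "(\<lambda>m. aw_up q a b c d (u m)) \<longlonglongrightarrow>
      (1 - a * b * 0) * (1 - a * c * 0) * (1 - a * d * 0) * (1 - a * b * c * d * 0 / of_real q) /
      (a * (1 - a * b * c * d * 0\<^sup>2 / of_real q) * (1 - a * b * c * d * 0\<^sup>2))"
    if "u \<longlonglongrightarrow> 0" for u :: "nat \<Rightarrow> complex"
    unfolding aw_up_def using n(1) q by (intro tendsto_intros that) auto
  from this[OF Q] have "(\<lambda>m. aw_up q a b c d (of_real q ^ Suc m)) \<longlonglongrightarrow> 1 / a"
    by simp
  moreover have "(\<lambda>m. aw_down q a b c d (u m)) \<longlonglongrightarrow>
      a * (1 - 0) * (1 - b * c * 0 / of_real q) * (1 - b * d * 0 / of_real q) * (1 - c * d * 0 / of_real q) /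
      ((1 - a * b * c * d * 0\<^sup>2 / (of_real q)\<^sup>2) * (1 - a * b * c * d * 0\<^sup>2 / of_real q))"
    if "u \<longlonglongrightarrow> 0" for u :: "nat \<Rightarrow> complex"
    unfolding aw_down_def using n(1) q by (intro tendsto_intros that) auto
  from this[OF Q] have "(\<lambda>m. aw_down q a b c d (of_real q ^ Suc m)) \<longlonglongrightarrow> a"
    by simp
  ultimately have "(\<lambda>m. a + 1 / a - aw_up q a b c d (of_real q ^ Suc m) - aw_down q a b c d (of_real q ^ Suc m)) \<longlonglongrightarrow>
      a + 1 / a - 1 / a - a"
    by (intro tendsto_diff tendsto_const)
  then have "(\<lambda>m. aw_beta q a b c d (Suc m)) \<longlonglongrightarrow> 0"
    by (simp add: aw_beta_def)
  then show ?thesis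
    by (rule LIMSEQ_imp_Suc)
qed

lemma continuous_on_aw_poly: "continuous_on S (aw_poly q m a b c d)"
proof -
  have "continuous_on S (\<lambda>\<theta>. qpoch q (a * b) m * qpoch q (a * c) m * qpoch q (a * d) m / a ^ m *
      aw_sum q a b c d (cis \<theta>) (of_real q ^ m) m)"
    unfolding aw_sum_def aw_basis_def qpoch_def using n(1) by (intro continuous_intros) auto
  then show ?thesis
    by (subst aw_poly_eq_aw_sum[OF n(1) order.refl, abs_def])
qed

end

end

section \<open>Growth and orthogonality\<close>

text \<open>
  With \<open>z = e\<^sup>i\<^sup>\<theta>\<close>, the differences \<open>d m = p (m + 1) - z p m\<close> satisfy \<open>d (m + 1) = d m / z\<close> up to a small
  error, which is why \<open>p\<close> grows subexponentially, uniformly in \<open>\<theta>\<close>.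
\<close>

lemma three_term_recurrence_growth:
  fixes p :: "nat \<Rightarrow> real \<Rightarrow> complex"
  assumes rec: "\<And>m \<theta>. of_real (2 * cos \<theta>) * p (Suc m) \<theta> = \<alpha> (Suc m) * p (Suc (Suc m)) \<theta> + \<beta> (Suc m) * p (Suc m) \<theta> + \<gamma> m * p m \<theta>"
    and lim: "\<alpha> \<longlonglongrightarrow> 1" "\<beta> \<longlonglongrightarrow> 0" "\<gamma> \<longlonglongrightarrow> 1"
    and nz: "\<And>m. \<alpha> m \<noteq> 0"
    and cont: "\<And>m. continuous_on S (p m)" and S: "compact S"
    and \<rho>: "1 < \<rho>"
  shows "\<exists>C. \<forall>m. \<forall>\<theta>\<in>S. norm (p m \<theta>) \<le> C * \<rho> ^ m"
proof -
  define \<eta> where "\<eta> = min 1 ((\<rho> - 1) / 2)"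
  define \<delta> where "\<delta> = \<eta>\<^sup>2 / 4"
  have \<eta>: "0 < \<eta>" "\<eta> \<le> 1" "1 + 2 * \<eta> \<le> \<rho>"
    using \<rho> by (auto simp: \<eta>_def min_def field_simps)
  have "\<eta> * \<eta> \<le> \<eta>" "0 < \<eta> * \<eta>"
    using mult_left_le[of \<eta> \<eta>] \<eta> by auto
  then have \<delta>: "0 < \<delta>" "2 * \<delta> \<le> \<eta> * \<eta>" "\<delta> \<le> \<eta>"
    using \<eta> by (auto simp: \<delta>_def power2_eq_square)
  define u where "u = (\<lambda>m. 2 * norm (1 / \<alpha> (Suc m) - 1) + norm (\<beta> (Suc m) / \<alpha> (Suc m)))"
  define v where "v = (\<lambda>m. norm (1 - \<gamma> m / \<alpha> (Suc m)))"
  note lim' = LIMSEQ_Suc[OF lim(1)] LIMSEQ_Suc[OF lim(2)]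
  have "u \<longlonglongrightarrow> 2 * norm (1 / 1 - 1 :: complex) + norm (0 / 1 :: complex)"
    unfolding u_def by (intro tendsto_intros lim') auto
  moreover have "v \<longlonglongrightarrow> norm (1 - 1 / 1 :: complex)"
    unfolding v_def by (intro tendsto_intros lim' lim) auto
  ultimately have "\<forall>\<^sub>F m in sequentially. u m < \<delta> \<and> v m < \<delta>"
    using \<delta>(1) by (intro eventually_conj order_tendstoD) auto
  then obtain M where M: "\<And>m. m \<ge> M \<Longrightarrow> u m < \<delta> \<and> v m < \<delta>"
    by (auto simp: eventually_sequentially)
  define N where "N = (\<lambda>m \<theta>. \<eta> * norm (p m \<theta>) + norm (p (Suc m) \<theta> - cis \<theta> * p m \<theta>))"
  have step: "N (Suc m) \<theta> \<le> \<rho> * N m \<theta>" if "m \<ge> M" for m \<theta>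
  proof -
    define z where "z = cis \<theta>"
    have z: "norm z = 1" "z \<noteq> 0"
      by (auto simp: z_def)
    define X where "X = complex_of_real (2 * cos \<theta>)"
    have X: "X = z + 1 / z"
      by (simp add: X_def z_def complex_eq_iff divide_inverse)
    have nX: "norm X \<le> 2"
      using abs_cos_le_one[of \<theta>] by (simp add: X_def norm_mult)
    define P0 where "P0 = p m \<theta>"
    define P1 where "P1 = p (Suc m) \<theta>"
    define P2 where "P2 = p (Suc (Suc m)) \<theta>"
    define D where "D = P1 - z * P0"
    define e where "e = (X * (1 / \<alpha> (Suc m) - 1) - \<beta> (Suc m) / \<alpha> (Suc m)) * P1 + (1 - \<gamma> m / \<alpha> (Suc m)) * P0"
    have "P2 = (X * P1 - \<beta> (Suc m) * P1 - \<gamma> m * P0) / \<alpha> (Suc m)"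
      using rec[of \<theta> m, folded P0_def P1_def P2_def X_def] nz[of "Suc m"]
      by (simp add: eq_divide_eq algebra_simps)
    then have "P2 = X * P1 - P0 + e"
      by (simp add: e_def algebra_simps diff_divide_distrib add_divide_distrib)
    then have D2: "P2 - z * P1 = D / z + e"
      using z by (simp add: X D_def field_simps)
    have "norm (X * (1 / \<alpha> (Suc m) - 1) - \<beta> (Suc m) / \<alpha> (Suc m)) \<le> u m"
      unfolding u_def
      by (rule order_trans[OF norm_triangle_ineq4]) (auto simp: norm_mult intro!: add_mono mult_right_mono nX)
    then have "norm e \<le> u m * norm P1 + v m * norm P0"
      unfolding e_def v_def
      by (intro order_trans[OF norm_triangle_ineq] add_mono) (auto simp: norm_mult intro!: mult_right_mono)
    also have "\<dots> \<le> \<delta> * norm P1 + \<delta> * norm P0"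
      using M[OF that] by (intro add_mono mult_right_mono) auto
    finally have e: "norm e \<le> \<delta> * norm P1 + \<delta> * norm P0" .
    have P1: "norm P1 \<le> norm P0 + norm D"
      using norm_triangle_ineq[of "z * P0" D] z by (simp add: D_def norm_mult)
    have "norm (P2 - z * P1) \<le> norm D + norm e"
      unfolding D2 using norm_triangle_ineq[of "D / z" e] z by (simp add: norm_divide)
    then have "N (Suc m) \<theta> \<le> (\<eta> + \<delta>) * norm P1 + norm D + \<delta> * norm P0"
      using e by (simp add: N_def P1_def P2_def z_def algebra_simps)
    also have "\<dots> \<le> (\<eta> + \<delta>) * (norm P0 + norm D) + norm D + \<delta> * norm P0"
      using P1 \<eta> \<delta> by (intro add_mono mult_left_mono) auto
    also have "\<dots> = (\<eta> + 2 * \<delta>) * norm P0 + (1 + (\<eta> + \<delta>)) * norm D"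
      by (simp add: algebra_simps)
    also have "\<dots> \<le> (\<eta> + 2 * \<eta> * \<eta>) * norm P0 + (1 + 2 * \<eta>) * norm D"
      using \<eta> \<delta> by (intro add_mono mult_right_mono) auto
    also have "\<dots> = (1 + 2 * \<eta>) * N m \<theta>"
      by (simp add: N_def P0_def P1_def D_def z_def algebra_simps)
    also have "\<dots> \<le> \<rho> * N m \<theta>"
      using \<eta> by (intro mult_right_mono) (auto simp: N_def)
    finally show ?thesis .
  qed
  have iter: "N (M + k) \<theta> \<le> N M \<theta> * \<rho> ^ k" for k \<theta>
  proof (induction k)
    case (Suc k)
    have "N (M + Suc k) \<theta> \<le> \<rho> * N (M + k) \<theta>"
      using step[of "M + k"] by simp
    also have "\<dots> \<le> \<rho> * (N M \<theta> * \<rho> ^ k)"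
      using Suc \<rho> by (intro mult_left_mono) auto
    finally show ?case
      by (simp add: mult_ac)
  qed simp
  have "\<exists>B. \<forall>\<theta>\<in>S. norm (p m \<theta>) \<le> B" for m
    using compact_imp_bounded[OF compact_continuous_image[OF cont S]] by (auto simp: bounded_iff)
  then obtain B where B: "\<And>m \<theta>. \<theta> \<in> S \<Longrightarrow> norm (p m \<theta>) \<le> B m"
    by metis
  define K where "K = (\<Sum>m\<le>Suc M. \<bar>B m\<bar>)"
  have K: "norm (p m \<theta>) \<le> K" if "m \<le> Suc M" "\<theta> \<in> S" for m \<theta>
  proof -
    have "norm (p m \<theta>) \<le> \<bar>B m\<bar>"
      using B[OF that(2), of m] by linarith
    also have "\<dots> \<le> K"
      unfolding K_def using that by (intro member_le_sum) auto
    finally show ?thesis .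
  qed
  have K0: "0 \<le> K"
    by (auto simp: K_def intro!: sum_nonneg)
  show ?thesis
  proof (intro exI[of _ "3 * K / \<eta>"] allI ballI)
    fix m \<theta> assume \<theta>: "\<theta> \<in> S"
    show "norm (p m \<theta>) \<le> 3 * K / \<eta> * \<rho> ^ m"
    proof (cases "m \<le> M")
      case True
      have "norm (p m \<theta>) \<le> K * 1"
        using K[of m \<theta>] True \<theta> by simp
      also have "\<dots> \<le> 3 * K / \<eta> * \<rho> ^ m"
        using K0 \<eta> \<rho> mult_left_le[of \<eta> K] by (intro mult_mono) (auto simp: field_simps)
      finally show ?thesis .
    next
      case False
      then obtain k where k: "m = M + k"
        by (metis le_add_diff_inverse nat_le_linear)
      have "norm (p (Suc M) \<theta> - cis \<theta> * p M \<theta>) \<le> K + K"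
        using K[of M \<theta>] K[of "Suc M" \<theta>] \<theta> by (intro order_trans[OF norm_triangle_ineq4]) (auto simp: norm_mult)
      moreover have "\<eta> * norm (p M \<theta>) \<le> 1 * K"
        using K[of M \<theta>] \<theta> \<eta> by (intro mult_mono) auto
      ultimately have NM: "N M \<theta> \<le> 3 * K"
        by (simp add: N_def)
      have "\<eta> * norm (p m \<theta>) \<le> N m \<theta>"
        by (simp add: N_def)
      also have "\<dots> \<le> N M \<theta> * \<rho> ^ k"
        unfolding k by (rule iter)
      also have "\<dots> \<le> 3 * K * \<rho> ^ m"
        using NM K0 \<rho> by (intro mult_mono) (auto simp: k N_def intro!: power_increasing)
      finally show ?thesis
        using \<eta> by (simp add: field_simps)
    qed
  qed
qed

text \<open>Favard: the recurrence determines \<open>L (p\<^sub>m p\<^sub>n)\<close> from \<open>L (p\<^sub>0 p\<^sub>n)\<close>; here \<open>Y m n\<close> stands for \<open>L (x p\<^sub>m p\<^sub>n)\<close>.\<close>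

lemma three_term_recurrence_orthogonal:
  fixes J Y :: "nat \<Rightarrow> nat \<Rightarrow> complex"
  assumes sym: "\<And>m n. J m n = J n m" "\<And>m n. Y m n = Y n m"
    and rec0: "\<And>n. Y 0 n = \<alpha> 0 * J 1 n + \<beta> 0 * J 0 n"
    and rec: "\<And>m n. Y (Suc m) n = \<alpha> (Suc m) * J (Suc (Suc m)) n + \<beta> (Suc m) * J (Suc m) n + \<gamma> m * J m n"
    and nz: "\<And>m. \<alpha> m \<noteq> 0"
    and J0: "\<And>n. J 0 (Suc n) = 0"
  shows "m < n \<Longrightarrow> J m n = 0" "J (Suc m) (Suc m) = \<gamma> m / \<alpha> m * J m m"
proof -
  have orth: "\<forall>k\<le>m. \<forall>n>k. J k n = 0" for m
  proof (induction m)
    case 0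
    show ?case
      using J0 by (auto simp: gr0_conv_Suc)
  next
    case (Suc m)
    have IH: "J k n = 0" "J n k = 0" if "k \<le> m" "k < n" for k n
      using Suc that sym by auto
    have "J (Suc m) n = 0" if "Suc m < n" for n
    proof -
      obtain l where l: "n = Suc l" "m < l"
        using \<open>Suc m < n\<close> by (cases n) auto
      have "Y n m = 0"
        using rec[of l m] \<open>Suc m < n\<close> l by (simp add: IH)
      then have "Y m n = 0"
        by (simp only: sym(2)[of m n])
      moreover have "Y m n = \<alpha> m * J (Suc m) n"
        using that rec0 rec by (cases m) (auto simp: IH)
      ultimately show ?thesis
        using nz by simp
    qed
    then show ?case
      using Suc by (auto simp: le_Suc_eq)
  qed
  then show orth': "m < n \<Longrightarrow> J m n = 0" for m n
    by blast
  have "Y m (Suc m) = \<alpha> m * J (Suc m) (Suc m)"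
    using rec0 rec by (cases m) (auto simp: orth')
  moreover have "J (Suc m) m = 0" "J (Suc (Suc m)) m = 0"
    unfolding sym(1)[of "Suc m" m] sym(1)[of "Suc (Suc m)" m] by (simp_all add: orth')
  then have "Y (Suc m) m = \<gamma> m * J m m"
    using rec[of m m] by simp
  ultimately show "J (Suc m) (Suc m) = \<gamma> m / \<alpha> m * J m m"
    using nz[of m] sym(2)[of m "Suc m"] by (simp add: field_simps)
qed

context
  fixes q :: real
  assumes q: "0 < q" "q < 1"
begin

lemma sum_qpoch_telescope:
  assumes "\<And>k. 1 - A * B * of_real q * of_real q ^ k \<noteq> 0"
  shows "(\<Sum>k\<le>N. qpoch q A k * qpoch q B k * of_real q ^ k / (qpoch q (of_real q) k * qpoch q (A * B * of_real q) k)) =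
    qpoch q (A * of_real q) N * qpoch q (B * of_real q) N / (qpoch q (of_real q) N * qpoch q (A * B * of_real q) N)"
proof (induction N)
  case (Suc N)
  define p where "p = complex_of_real q"
  define x where "x = p * p ^ N"
  have nz: "qpoch q p N \<noteq> 0" "1 - x \<noteq> 0" "qpoch q (A * B * p) N \<noteq> 0" "1 - A * B * x \<noteq> 0"
  proof -
    have "norm p < 1"
      using q by (simp add: p_def)
    then show "qpoch q p N \<noteq> 0" "1 - x \<noteq> 0"
      unfolding x_def p_def by (auto intro!: qpoch_nz[OF q] one_minus_q_power_nz[OF q] simp del: right_minus_eq)
    show "qpoch q (A * B * p) N \<noteq> 0" "1 - A * B * x \<noteq> 0"
      using assms[of N] assms by (simp_all add: qpoch_def x_def p_def mult_ac del: right_minus_eq)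
  qed
  define E F G H where "E = qpoch q (A * p) N" and "F = qpoch q (B * p) N" and "G = qpoch q p N" and "H = qpoch q (A * B * p) N"
  have "E * F / (G * H) + (1 - A) * E * ((1 - B) * F) * x / (G * (1 - x) * (H * (1 - A * B * x))) =
     E * F * ((1 - x) * (1 - A * B * x) + (1 - A) * (1 - B) * x) / (G * (1 - x) * (H * (1 - A * B * x)))"
    using nz by (simp add: G_def H_def divide_simps del: right_minus_eq) (simp add: algebra_simps)
  also have "(1 - x) * (1 - A * B * x) + (1 - A) * (1 - B) * x = (1 - A * x) * (1 - B * x)"
    by algebra
  finally have *: "E * F / (G * H) + (1 - A) * E * ((1 - B) * F) * x / (G * (1 - x) * (H * (1 - A * B * x))) =
     E * F * ((1 - A * x) * (1 - B * x)) / (G * (1 - x) * (H * (1 - A * B * x)))" .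
  have qp: "qpoch q A (Suc N) = (1 - A) * E" "qpoch q B (Suc N) = (1 - B) * F" "p ^ Suc N = x"
    "qpoch q p (Suc N) = G * (1 - x)" "qpoch q (A * B * p) (Suc N) = H * (1 - A * B * x)"
    "qpoch q (A * p) (Suc N) = E * (1 - A * x)" "qpoch q (B * p) (Suc N) = F * (1 - B * x)"
    by (simp_all add: qpoch_Suc_left[of q A] qpoch_Suc_left[of q B])
      (simp_all add: qpoch_Suc E_def F_def G_def H_def x_def p_def mult.assoc)
  show ?case
    using * Suc unfolding sum.atMost_Suc p_def[symmetric] qp E_def[symmetric] F_def[symmetric] G_def[symmetric] H_def[symmetric]
    by (simp add: mult_ac)
qed simp

context
  fixes a b c d T :: complex
  assumes n: "a \<noteq> 0" "norm a < 1" "norm b < 1" "norm c < 1" "norm d < 1"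
    and T: "T = a * b * c * d"
begin

lemma aw_poly_growth:
  assumes "1 < \<rho>"
  shows "\<exists>C. \<forall>m. \<forall>\<theta>\<in>{0..pi}. norm (aw_poly q m a b c d \<theta>) \<le> C * \<rho> ^ m"
  by (rule three_term_recurrence_growth[OF aw_poly_recurrence[OF q n T] aw_alpha_tendsto[OF q n T]
    aw_beta_tendsto[OF q n T] aw_gamma_tendsto[OF q n T] aw_alpha_nz[OF q n T]
    continuous_on_aw_poly[OF q n T] compact_Icc assms])

lemma integral_aw_weight_basis:
  "integral {0..pi} (\<lambda>\<theta>. aw_weight q a b c d \<theta> * aw_basis q a (cis \<theta>) k) =
    qpoch q (a * b) k * qpoch q (a * c) k * qpoch q (a * d) k / qpoch q T k * integral {0..pi} (aw_weight q a b c d)"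
proof -
  have lt: "norm (a * of_real q ^ k) < 1"
    using norm_mult_q_power_less[OF q n(2)] .
  have s: "qpoch_inf q (a * x) = qpoch q (a * x) k * qpoch_inf q (a * of_real q ^ k * x)" for x
    using qpoch_inf_shift[OF q, of "a * x" k] by (simp add: mult_ac)
  have s4: "qpoch_inf q (a * b * c * d) = qpoch q T k * qpoch_inf q (a * of_real q ^ k * b * c * d)"
    using qpoch_inf_shift[OF q, of T k] by (simp add: T mult_ac)
  have nz: "qpoch q T k \<noteq> 0"
    using norm_T[OF q n T] by (intro qpoch_nz[OF q])
  have nz': "qpoch q (a * x) k \<noteq> 0" if "norm x < 1" for x
    using norm_mult_less_1[OF n(2) that] by (intro qpoch_nz[OF q])
  have "integral {0..pi} (\<lambda>\<theta>. aw_weight q a b c d \<theta> * aw_basis q a (cis \<theta>) k) =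
      integral {0..pi} (aw_weight q (a * of_real q ^ k) b c d)"
    unfolding aw_basis_def using aw_weight_shift[OF q n(2)] by presburger
  then show ?thesis
    unfolding aw_integral[OF q lt n(3-5)] aw_integral[OF q n(2-5)] s s4
    using nz nz'[OF n(3)] nz'[OF n(4)] nz'[OF n(5)] by (simp add: mult_ac)
qed

lemma integral_aw_weight_poly:
  "integral {0..pi} (\<lambda>\<theta>. aw_weight q a b c d \<theta> * aw_poly q (Suc m) a b c d \<theta>) = 0"
proof -
  define I where "I = integral {0..pi} (aw_weight q a b c d)"
  define Q where "Q = complex_of_real q ^ Suc m"
  define p where "p = complex_of_real q"
  define G where "G = qpoch q (a * b) (Suc m) * qpoch q (a * c) (Suc m) * qpoch q (a * d) (Suc m) / a ^ Suc m"
  have p: "p \<noteq> 0"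
    using q by (simp add: p_def)
  have Q: "Q \<noteq> 0" "Q = p ^ Suc m"
    using p by (simp_all add: Q_def p_def)
  have nz: "qpoch q (a * x) k \<noteq> 0" if "norm x < 1" for x k
    using norm_mult_less_1[OF n(2) that] by (auto intro!: qpoch_nz[OF q])
  have "integral {0..pi} (\<lambda>\<theta>. aw_weight q a b c d \<theta> * aw_poly q (Suc m) a b c d \<theta>) =
      integral {0..pi} (\<lambda>\<theta>. \<Sum>k\<le>Suc m. G * aw_num q T Q k * aw_den q a b c d k *
        (aw_weight q a b c d \<theta> * aw_basis q a (cis \<theta>) k))"
    unfolding aw_poly_eq_aw_sum[OF q n(1) order.refl] aw_sum_def
    by (simp add: G_def Q_def T sum_distrib_left mult_ac del: sum.atMost_Suc power_Suc)
  also have "\<dots> = (\<Sum>k\<le>Suc m. G * aw_num q T Q k * aw_den q a b c d k *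
        integral {0..pi} (\<lambda>\<theta>. aw_weight q a b c d \<theta> * aw_basis q a (cis \<theta>) k))"
    by (subst integral_sum)
      (auto intro!: integrable_continuous_real continuous_intros continuous_on_aw_weight[OF q] n
        simp: aw_basis_def qpoch_def simp del: sum.atMost_Suc)
  also have "\<dots> = (\<Sum>k\<le>Suc m. G * I * (qpoch q (1 / Q) k * qpoch q (T * Q / p) k * p ^ k / (qpoch q p k * qpoch q T k)))"
    unfolding integral_aw_weight_basis I_def[symmetric] using nz n
    by (intro sum.cong) (simp_all add: aw_num_def aw_den_def p_def)
  also have "\<dots> = G * I * (\<Sum>k\<le>Suc m. qpoch q (1 / Q) k * qpoch q (T * Q / p) k * p ^ k / (qpoch q p k * qpoch q (1 / Q * (T * Q / p) * p) k))"
    using Q p by (simp add: sum_distrib_left del: sum.atMost_Suc)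
  also have "(\<Sum>k\<le>Suc m. qpoch q (1 / Q) k * qpoch q (T * Q / p) k * p ^ k / (qpoch q p k * qpoch q (1 / Q * (T * Q / p) * p) k)) =
      qpoch q (1 / Q * p) (Suc m) * qpoch q (T * Q / p * p) (Suc m) / (qpoch q p (Suc m) * qpoch q (1 / Q * (T * Q / p) * p) (Suc m))"
    using p Q T_nz(1)[OF q n T] unfolding p_def by (intro sum_qpoch_telescope) simp
  also have "qpoch q (1 / Q * p) (Suc m) = 0"
    using p by (simp add: qpoch_Suc Q p_def)
  finally show ?thesis
    by simp
qed

lemma aw_norm_0: "aw_norm q 0 a b c d = integral {0..pi} (aw_weight q a b c d)"
  unfolding aw_integral[OF q n(2-5)] by (simp add: aw_norm_def mult_ac)

lemma aw_norm_Suc: "aw_norm q (Suc m) a b c d = aw_gamma q a b c d m / aw_alpha q T m * aw_norm q m a b c d"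
proof -
  define p where "p = complex_of_real q"
  have p: "p \<noteq> 0"
    using q by (simp add: p_def)
  have nT: "1 - T * p ^ k \<noteq> 0" "1 - T \<noteq> 0" for k
    using T_nz[OF q n T] by (simp_all add: p_def)
  define A where "A = (\<lambda>m. qpoch q (T * p powi (int m - 1)) m)"
  have pp: "p powi (int (Suc j) - 1) = p ^ j" for j
    by simp
  have A: "A (Suc m) * aw_alpha q T m = A m"
  proof (cases m)
    case 0
    then show ?thesis
      using nT by (simp add: A_def aw_alpha_def qpoch_Suc p_def del: right_minus_eq)
  next
    case (Suc j)
    define E where "E = qpoch q (T * p ^ j * p) j"
    have 1: "A m = (1 - T * p ^ j) * E"
      unfolding A_def Suc pp by (simp add: E_def p_def qpoch_Suc_left)
    have 2: "A (Suc m) = E * (1 - T * p ^ (2 * j + 1)) * (1 - T * p ^ (2 * j + 2))"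
      unfolding A_def Suc pp by (simp add: E_def p_def qpoch_Suc mult_ac mult_2_right power_add)
    have 3: "aw_alpha q T m = (1 - T * p ^ j) / ((1 - T * p ^ (2 * j + 1)) * (1 - T * p ^ (2 * j + 2)))"
      using Suc by (simp add: aw_alpha_def p_def)
    show ?thesis
      unfolding 1 2 3 using nT(1)[of "2 * j + 1"] nT(1)[of "2 * j + 2"] by (simp del: right_minus_eq)
  qed
  have s: "qpoch_inf q (x * p ^ m) = (1 - x * p ^ m) * qpoch_inf q (x * p ^ Suc m)" for x
    using qpoch_inf_step[OF q, of "x * p ^ m"] by (simp add: p_def mult_ac)
  have s1: "qpoch_inf q (p ^ (m + 1)) = (1 - p ^ Suc m) * qpoch_inf q (p ^ (Suc m + 1))"
    using qpoch_inf_step[OF q, of "p ^ Suc m"] by (simp add: p_def mult_ac)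
  have s2: "qpoch_inf q (T * p ^ (2 * m)) = (1 - T * p ^ (2 * m)) * (1 - T * p ^ (2 * m + 1)) * qpoch_inf q (T * p ^ (2 * Suc m))"
    using qpoch_inf_step[OF q, of "T * p ^ (2 * m)"] qpoch_inf_step[OF q, of "T * p ^ (2 * m + 1)"]
    by (simp add: p_def mult_ac)
  define P where "P = (\<lambda>k. qpochs_inf q [a * b * p ^ k, a * c * p ^ k, a * d * p ^ k, b * c * p ^ k, b * d * p ^ k, c * d * p ^ k])"
  define g where "g = (1 - a * b * p ^ m) * (1 - a * c * p ^ m) * (1 - a * d * p ^ m) *
      ((1 - b * c * p ^ m) * (1 - b * d * p ^ m) * (1 - c * d * p ^ m))"
  have P: "P m = g * P (Suc m)"
    unfolding P_def qpochs_simps s by (simp add: g_def mult_ac)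
  have N: "aw_norm q k a b c d = 2 * of_real pi * qpoch_inf q (T * p ^ (2 * k)) * A k / (qpoch_inf q (p ^ (k + 1)) * P k)" for k
    by (simp add: aw_norm_def A_def P_def T p_def mult_ac)
  have nx: "1 - x * p ^ m \<noteq> 0" if "norm x < 1" for x
    using one_minus_q_power_nz[OF q that] by (simp add: p_def)
  have "norm p < 1"
    using q by (simp add: p_def)
  then have g: "g \<noteq> 0" "1 - p ^ Suc m \<noteq> 0"
    using nx[of p] unfolding g_def by (auto intro!: nx norm_mult_less_1 n simp del: right_minus_eq)
  have al: "aw_alpha q T m \<noteq> 0"
    by (rule aw_alpha_nz[OF q n T])
  define t1 t2 where "t1 = 1 - T * p ^ (2 * m)" and "t2 = 1 - T * p ^ (2 * m + 1)"
  have t: "t1 \<noteq> 0" "t2 \<noteq> 0"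
    using nT unfolding t1_def t2_def by blast+
  have ga: "aw_gamma q a b c d m = (1 - p ^ Suc m) * g / (t1 * t2)"
    by (simp add: aw_gamma_def g_def t1_def t2_def T p_def)
  show ?thesis
    unfolding N[of m] N[of "Suc m"] ga s1 s2 A[symmetric] P t1_def[symmetric] t2_def[symmetric] using t g al by simp
qed

lemma aw_orthogonality:
  "integral {0..pi} (\<lambda>\<theta>. aw_weight q a b c d \<theta> * (aw_poly q m a b c d \<theta> * aw_poly q l a b c d \<theta>)) =
    (if m = l then aw_norm q m a b c d else 0)"
proof -
  let ?w = "aw_weight q a b c d" and ?p = "\<lambda>m. aw_poly q m a b c d"
  define J where "J = (\<lambda>m l. integral {0..pi} (\<lambda>\<theta>. ?w \<theta> * (?p m \<theta> * ?p l \<theta>)))"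
  define Y where "Y = (\<lambda>m l. integral {0..pi} (\<lambda>\<theta>. ?w \<theta> * (of_real (2 * cos \<theta>) * ?p m \<theta> * ?p l \<theta>)))"
  have int: "(\<lambda>\<theta>. x * (?w \<theta> * (?p m \<theta> * ?p l \<theta>))) integrable_on {0..pi}" for x m l
    by (intro integrable_continuous_real continuous_intros continuous_on_aw_weight[OF q]
      continuous_on_aw_poly[OF q n T] n)
  have rec0: "Y 0 l = aw_alpha q T 0 * J 1 l + aw_beta q a b c d 0 * J 0 l" for l
  proof -
    have "Y 0 l = integral {0..pi} (\<lambda>\<theta>. aw_alpha q T 0 * (?w \<theta> * (?p 1 \<theta> * ?p l \<theta>)) +
        aw_beta q a b c d 0 * (?w \<theta> * (?p 0 \<theta> * ?p l \<theta>)))"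
      unfolding Y_def aw_poly_recurrence_0[OF q n T] by (simp only: algebra_simps)
    then show ?thesis
      unfolding J_def using int by (simp add: integral_add)
  qed
  have rec: "Y (Suc m) l = aw_alpha q T (Suc m) * J (Suc (Suc m)) l + aw_beta q a b c d (Suc m) * J (Suc m) l +
      aw_gamma q a b c d m * J m l" for m l
  proof -
    have "Y (Suc m) l = integral {0..pi} (\<lambda>\<theta>. aw_alpha q T (Suc m) * (?w \<theta> * (?p (Suc (Suc m)) \<theta> * ?p l \<theta>)) +
        aw_beta q a b c d (Suc m) * (?w \<theta> * (?p (Suc m) \<theta> * ?p l \<theta>)) +
        aw_gamma q a b c d m * (?w \<theta> * (?p m \<theta> * ?p l \<theta>)))"
      unfolding Y_def aw_poly_recurrence[OF q n T] by (simp only: algebra_simps)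
    then show ?thesis
      unfolding J_def using int by (simp add: integral_add integrable_add)
  qed
  have sym: "J m l = J l m" "Y m l = Y l m" for m l
    by (simp_all add: J_def Y_def mult_ac)
  have J0: "J 0 (Suc l) = 0" for l
    unfolding J_def aw_poly_0[OF q n T] using integral_aw_weight_poly by simp
  note fav = three_term_recurrence_orthogonal[where J = J and Y = Y and \<alpha> = "aw_alpha q T" and
    \<beta> = "aw_beta q a b c d" and \<gamma> = "aw_gamma q a b c d", OF sym rec0 rec aw_alpha_nz[OF q n T] J0]
  have "J m m = aw_norm q m a b c d" for m
  proof (induction m)
    case 0
    show ?case
      by (simp add: J_def aw_poly_0[OF q n T] aw_norm_0)
  next
    case (Suc m)
    then show ?case
      using fav(2)[of m] aw_norm_Suc[of m] by simp
  qed
  moreover have "J m l = 0" if "m \<noteq> l"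
    using that fav(1)[of m l] fav(1)[of l m] sym(1)[of m l] by (cases "m < l") auto
  ultimately show ?thesis
    by (auto simp: J_def)
qed

end

end

section \<open>The kernel\<close>

lemma integral_uniform_series:
  fixes f :: "nat \<Rightarrow> real \<Rightarrow> complex"
  assumes cont: "\<And>n. continuous_on {a..b} (f n)"
    and bound: "\<And>n x. x \<in> {a..b} \<Longrightarrow> norm (f n x) \<le> M n" and M: "summable M"
  shows "continuous_on {a..b} (\<lambda>x. \<Sum>n. f n x)"
    and "(\<lambda>n. integral {a..b} (f n)) sums integral {a..b} (\<lambda>x. \<Sum>n. f n x)"
proof -
  have lim: "uniform_limit {a..b} (\<lambda>n x. \<Sum>i<n. f i x) (\<lambda>x. \<Sum>i. f i x) sequentially"
    by (rule Weierstrass_m_test[OF bound M])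
  have c: "continuous_on {a..b} (\<lambda>x. \<Sum>i<n. f i x)" for n
    by (intro continuous_intros cont)
  show "continuous_on {a..b} (\<lambda>x. \<Sum>n. f n x)"
    by (rule uniform_limit_theorem[OF _ lim]) (auto intro: always_eventually c)
  obtain I J where I: "\<And>n. ((\<lambda>x. \<Sum>i<n. f i x) has_integral I n) {a..b}"
    and J: "((\<lambda>x. \<Sum>i. f i x) has_integral J) {a..b}" and IJ: "I \<longlonglongrightarrow> J"
    using uniform_limit_integral[OF lim c] by auto
  have "I n = (\<Sum>i<n. integral {a..b} (f i))" for n
  proof -
    have "I n = integral {a..b} (\<lambda>x. \<Sum>i<n. f i x)"
      by (rule integral_unique[OF I, symmetric])
    also have "\<dots> = (\<Sum>i<n. integral {a..b} (f i))"
      by (intro integral_sum integrable_continuous_real cont) auto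
    finally show ?thesis .
  qed
  then have "I = (\<lambda>n. \<Sum>i<n. integral {a..b} (f i))"
    by blast
  then show "(\<lambda>n. integral {a..b} (f n)) sums integral {a..b} (\<lambda>x. \<Sum>n. f n x)"
    using IJ unfolding sums_def integral_unique[OF J] by simp
qed

lemma zero_cosine_moments_real:
  fixes g :: "real \<Rightarrow> real"
  assumes g: "continuous_on {0..pi} g"
    and mom: "\<And>m. integral {0..pi} (\<lambda>\<theta>. g \<theta> * cos \<theta> ^ m) = 0"
    and \<theta>: "\<theta> \<in> {0..pi}"
  shows "g \<theta> = 0"
proof -
  have sq: "continuous_on {0..pi} (\<lambda>\<theta>. (g \<theta>)\<^sup>2)"
    by (intro continuous_intros g)
  have abs: "continuous_on {0..pi} (\<lambda>\<theta>. \<bar>g \<theta>\<bar>)"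
    by (intro continuous_intros g)
  have le: "integral {0..pi} (\<lambda>\<theta>. (g \<theta>)\<^sup>2) \<le> e * integral {0..pi} (\<lambda>\<theta>. \<bar>g \<theta>\<bar>)" if "e > 0" for e
  proof -
    have "continuous_on {-1..1} (\<lambda>x. g (arccos x))"
      by (rule continuous_on_compose2[OF g continuous_on_arccos']) (auto intro: arccos_lbound arccos_ubound)
    then obtain P where P: "real_polynomial_function P" "\<And>x. x \<in> {-1..1} \<Longrightarrow> \<bar>g (arccos x) - P x\<bar> < e"
      using Stone_Weierstrass_real_polynomial_function[OF compact_Icc _ \<open>e > 0\<close>] by metis
    then obtain c N where PN: "P = (\<lambda>x. \<Sum>i\<le>N. c i * x ^ i)"
      unfolding real_polynomial_function_iff_sum by blast
    have "integral {0..pi} (\<lambda>\<theta>. g \<theta> * P (cos \<theta>)) = integral {0..pi} (\<lambda>\<theta>. \<Sum>i\<le>N. c i * (g \<theta> * cos \<theta> ^ i))"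
      by (simp add: PN sum_distrib_left mult_ac)
    also have "\<dots> = (\<Sum>i\<le>N. c i * integral {0..pi} (\<lambda>\<theta>. g \<theta> * cos \<theta> ^ i))"
      by (subst integral_sum) (auto intro!: integrable_continuous_real continuous_intros g)
    finally have zero: "integral {0..pi} (\<lambda>\<theta>. g \<theta> * P (cos \<theta>)) = 0"
      by (simp add: mom)
    have cP: "continuous_on {0..pi} (\<lambda>\<theta>. g \<theta> * P (cos \<theta>))"
      unfolding PN by (intro continuous_intros g)
    have "integral {0..pi} (\<lambda>\<theta>. (g \<theta>)\<^sup>2) = integral {0..pi} (\<lambda>\<theta>. (g \<theta>)\<^sup>2 - g \<theta> * P (cos \<theta>))"
      using zero by (subst integral_diff) (auto intro!: integrable_continuous_real sq cP)
    also have "\<dots> \<le> integral {0..pi} (\<lambda>\<theta>. e * \<bar>g \<theta>\<bar>)"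
    proof (rule integral_le)
      fix \<theta> :: real assume \<theta>: "\<theta> \<in> {0..pi}"
      have "(g \<theta>)\<^sup>2 - g \<theta> * P (cos \<theta>) = g \<theta> * (g \<theta> - P (cos \<theta>))"
        by (simp add: power2_eq_square algebra_simps)
      also have "\<dots> \<le> \<bar>g \<theta>\<bar> * \<bar>g \<theta> - P (cos \<theta>)\<bar>"
        by (simp flip: abs_mult)
      also have "\<dots> \<le> \<bar>g \<theta>\<bar> * e"
        using P(2)[of "cos \<theta>"] \<theta> by (intro mult_left_mono) (auto simp: arccos_cos)
      finally show "(g \<theta>)\<^sup>2 - g \<theta> * P (cos \<theta>) \<le> e * \<bar>g \<theta>\<bar>"
        by (simp add: mult.commute)
    qed (auto intro!: integrable_continuous_real continuous_intros g simp: PN)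
    finally show ?thesis
      by simp
  qed
  have "integral {0..pi} (\<lambda>\<theta>. (g \<theta>)\<^sup>2) \<le> 0"
  proof (rule field_le_epsilon)
    fix e :: real assume "e > 0"
    define A where "A = integral {0..pi} (\<lambda>\<theta>. \<bar>g \<theta>\<bar>)"
    have A: "A \<ge> 0"
      unfolding A_def by (intro integral_nonneg integrable_continuous_real abs) auto
    have "integral {0..pi} (\<lambda>\<theta>. (g \<theta>)\<^sup>2) \<le> e / (A + 1) * A"
      unfolding A_def using \<open>e > 0\<close> A[unfolded A_def] by (intro le) auto
    also have "\<dots> \<le> 0 + e"
      using A \<open>e > 0\<close> by (simp add: field_simps)
    finally show "integral {0..pi} (\<lambda>\<theta>. (g \<theta>)\<^sup>2) \<le> 0 + e" .
  qed
  moreover have "integral {0..pi} (\<lambda>\<theta>. (g \<theta>)\<^sup>2) \<ge> 0"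
    by (intro integral_nonneg integrable_continuous_real sq) auto
  ultimately have "integral {0..pi} (\<lambda>\<theta>. (g \<theta>)\<^sup>2) = 0"
    by simp
  then have "\<forall>\<theta>\<in>{0..pi}. (g \<theta>)\<^sup>2 = 0"
    by (subst (asm) integral_eq_0_iff[OF sq]) auto
  then show ?thesis
    using \<theta> by simp
qed

lemma zero_cosine_moments:
  fixes f :: "real \<Rightarrow> complex"
  assumes f: "continuous_on {0..pi} f"
    and mom: "\<And>m. integral {0..pi} (\<lambda>\<theta>. of_real (cos \<theta>) ^ m * f \<theta>) = 0"
    and \<theta>: "\<theta> \<in> {0..pi}"
  shows "f \<theta> = 0"
proof -
  have hi: "((\<lambda>\<theta>. of_real (cos \<theta>) ^ m * f \<theta>) has_integral 0) {0..pi}" for m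
  proof -
    have "(\<lambda>\<theta>. of_real (cos \<theta>) ^ m * f \<theta>) integrable_on {0..pi}"
      by (intro integrable_continuous_real continuous_intros f)
    then show ?thesis
      using mom[of m] by (simp add: has_integral_iff)
  qed
  have "integral {0..pi} (\<lambda>\<theta>. Re (f \<theta>) * cos \<theta> ^ m) = 0" for m
    using has_integral_linear[OF hi[of m] bounded_linear_Re]
    by (simp add: o_def integral_unique mult.commute flip: of_real_power)
  then have "Re (f \<theta>) = 0"
    by (rule zero_cosine_moments_real[where g = "\<lambda>\<theta>. Re (f \<theta>)", OF _ _ \<theta>, rotated]) (intro continuous_intros f)
  moreover have "integral {0..pi} (\<lambda>\<theta>. Im (f \<theta>) * cos \<theta> ^ m) = 0" for m
    using has_integral_linear[OF hi[of m] bounded_linear_Im]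
    by (simp add: o_def integral_unique mult.commute flip: of_real_power)
  then have "Im (f \<theta>) = 0"
    by (rule zero_cosine_moments_real[where g = "\<lambda>\<theta>. Im (f \<theta>)", OF _ _ \<theta>, rotated]) (intro continuous_intros f)
  ultimately show ?thesis
    by (simp add: complex_eq_iff)
qed

definition aw_kernel :: "real \<Rightarrow> real \<Rightarrow> complex \<Rightarrow> complex \<Rightarrow> complex \<Rightarrow> complex \<Rightarrow> real \<Rightarrow> real \<Rightarrow> complex" where
  "aw_kernel q r t1 t2 t3 t4 \<phi> \<theta> = qpoch_inf q (of_real q) * qpoch_inf q (of_real (r\<^sup>2)) / (2 * of_real pi) *
     (h_prod q [t3, t4] \<phi> * h_prod q [t1 * of_real r, t2 * of_real r] \<theta>) /
     h_prod q [of_real r * exp (\<i> * of_real \<theta>), of_real r * exp (- \<i> * of_real \<theta>)] \<phi>"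

context
  fixes q :: real
  assumes q: "0 < q" "q < 1"
begin

lemma continuous_on_h_prod: "continuous_on S (h_prod q as)"
proof (induction as)
  case Nil
  show ?case
    by (simp add: h_prod_simps(1)[abs_def])
next
  case (Cons a as)
  then have "continuous_on S (\<lambda>\<theta>. qpair q a (cis \<theta>) * h_prod q as \<theta>)"
    by (intro continuous_intros continuous_on_qpair[OF q]) auto
  then show ?case
    by (simp add: h_prod_simps(2)[abs_def])
qed

lemma aw_weight_nz:
  assumes "norm a < 1" "norm b < 1" "norm c < 1" "norm d < 1" "0 < \<theta>" "\<theta> < pi"
  shows "aw_weight q a b c d \<theta> \<noteq> 0"
proof -
  have "(cis \<theta>)\<^sup>2 \<noteq> 1"
  proof
    assume "(cis \<theta>)\<^sup>2 = 1"
    then have "cis \<theta> = 1 \<or> cis \<theta> = -1"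
      by (simp add: power2_eq_1_iff)
    then have "sin \<theta> = 0"
      by (auto simp: complex_eq_iff)
    then show False
      using sin_gt_zero[of \<theta>] assms by simp
  qed
  then have "qpoch_inf q ((cis \<theta>)\<^sup>2) \<noteq> 0" "qpoch_inf q (1 / (cis \<theta>)\<^sup>2) \<noteq> 0"
    by (simp_all add: qpoch_inf_nz_circle[OF q] norm_power norm_divide)
  then show ?thesis
    using assms by (simp add: aw_weight_eq qpair_nz[OF q])
qed

context
  fixes r :: real
  assumes r: "\<bar>r\<bar> < 1" "r \<noteq> 0"
begin

lemma kernel_denominator_nz:
  "h_prod q [of_real r * exp (\<i> * of_real \<theta>), of_real r * exp (- \<i> * of_real \<theta>)] \<phi> \<noteq> 0"
  using r by (simp add: h_prod_simps norm_mult qpair_nz[OF q])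

lemma continuous_on_aw_kernel: "continuous_on S (\<lambda>\<phi>. aw_kernel q r t1 t2 t3 t4 \<phi> \<theta>)"
  unfolding aw_kernel_def
  by (intro continuous_on_divide continuous_on_mult continuous_on_const continuous_on_h_prod
    kernel_denominator_nz ballI) simp

context
  fixes t1 t2 t3 t4 s1 s2 s3 s4 :: complex
  assumes t: "t1 \<noteq> 0" "norm t1 < 1" "norm t2 < 1" "norm t3 < 1" "norm t4 < 1"
    and s: "s1 = t1 * of_real r" "s2 = t2 * of_real r" "s3 = t3 / of_real r" "s4 = t4 / of_real r"
    and n3: "norm s3 < 1" and n4: "norm s4 < 1"
begin

lemma norm_s: "s1 \<noteq> 0" "norm s1 < 1" "norm s2 < 1" "norm s3 < 1" "norm s4 < 1"
proof -
  have "norm (complex_of_real r) < 1"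
    using r by simp
  then show "norm s1 < 1" "norm s2 < 1"
    unfolding s using t by (simp_all only: norm_mult_less_1)
  show "s1 \<noteq> 0"
    using t r by (simp add: s)
qed (rule n3, rule n4)

lemma aw_weight_times_kernel:
  "aw_weight q t1 t2 t3 t4 \<phi> * aw_kernel q r t1 t2 t3 t4 \<phi> \<theta> =
    qpoch_inf q (of_real q) * qpoch_inf q (of_real (r\<^sup>2)) / (2 * of_real pi) * h_prod q [s1, s2] \<theta> *
    aw_weight q t1 t2 (of_real r * exp (\<i> * of_real \<theta>)) (of_real r * exp (- \<i> * of_real \<theta>)) \<phi>"
proof -
  have "qpair q t3 (cis \<phi>) \<noteq> 0" "qpair q t4 (cis \<phi>) \<noteq> 0"
    using t by (simp_all add: qpair_nz[OF q])
  then show ?thesis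
    by (simp add: aw_weight_eq aw_kernel_def h_prod_simps s mult_ac)
qed

text \<open>
  The kernel maps \<open>p\<^sub>n(\<cdot>; t)\<close> to \<open>c\<^sub>n p\<^sub>n(\<cdot>; s)\<close>: term by term in the series for \<open>p\<^sub>n\<close>, this is the
  Askey--Wilson integral with parameters \<open>t\<^sub>1 q\<^sup>k, t\<^sub>2, r e\<^sup>i\<^sup>\<theta>, r e\<^sup>-\<^sup>i\<^sup>\<theta>\<close>.
\<close>

lemma aw_kernel_transform:
  "integral {0..pi} (\<lambda>\<phi>. aw_weight q t1 t2 t3 t4 \<phi> * (aw_kernel q r t1 t2 t3 t4 \<phi> \<theta> * aw_poly q n t1 t2 t3 t4 \<phi>)) =
    connection_coeff q r t1 t2 n * aw_poly q n s1 s2 s3 s4 \<theta>"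
proof -
  define z where "z = cis \<theta>"
  define x y where "x = of_real r * exp (\<i> * of_real \<theta>)" and "y = of_real r * exp (- \<i> * of_real \<theta>)"
  have z: "z \<noteq> 0" "norm z = 1"
    by (auto simp: z_def)
  have xz: "x = of_real r * z" "y = of_real r / z"
    by (simp_all add: x_def y_def z_def cis_conv_exp exp_minus divide_inverse)
  have nxy: "norm x < 1" "norm y < 1"
    using r z by (auto simp: xz norm_mult norm_divide)
  have xy: "x * y = of_real (r\<^sup>2)"
    using z by (simp add: xz power2_eq_square)
  have tx: "t1 * x = s1 * z" "t1 * y = s1 / z" "t2 * x = s2 * z" "t2 * y = s2 / z"
    by (simp_all add: xz s)
  have ss: "s1 * s2 = t1 * t2 * of_real (r\<^sup>2)" "s1 * s3 = t1 * t3" "s1 * s4 = t1 * t4"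
    "s1 * s2 * s3 * s4 = t1 * t2 * t3 * t4" "t1 * t2 * x * y = s1 * s2"
    using r z by (simp_all add: s xz power2_eq_square)
  define T where "T = t1 * t2 * t3 * t4"
  define Q where "Q = complex_of_real q ^ n"
  define G where "G = (\<lambda>a b c d. qpoch q (a * b) n * qpoch q (a * c) n * qpoch q (a * d) n / a ^ n)"
  define C where "C = qpoch_inf q (of_real q) * qpoch_inf q (of_real (r\<^sup>2)) / (2 * of_real pi) * h_prod q [s1, s2] \<theta>"
  define I where "I = integral {0..pi} (aw_weight q t1 t2 x y)"
  have nz: "qpoch q (t1 * t2) k \<noteq> 0" "qpoch q (t1 * t3) k \<noteq> 0" "qpoch q (t1 * t4) k \<noteq> 0" "qpoch q (s1 * s2) k \<noteq> 0" for k
    using t norm_s by (simp_all add: qpoch_nz[OF q] norm_mult_less_1)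
  have "norm (complex_of_real (r\<^sup>2)) < 1"
    unfolding xy[symmetric] using nxy by (rule norm_mult_less_1)
  moreover have "norm (complex_of_real q) < 1"
    using q by simp
  ultimately have nzi: "qpoch_inf q (of_real (r\<^sup>2)) \<noteq> 0" "qpoch_inf q (of_real q) \<noteq> 0" "qpoch_inf q (t1 * t2) \<noteq> 0"
    "qpair q s1 z \<noteq> 0" "qpair q s2 z \<noteq> 0"
    using t norm_s z by (simp_all add: qpoch_inf_nz[OF q] norm_mult_less_1 qpair_nz[OF q] del: of_real_power)
  have I: "C * I = qpoch_inf q (s1 * s2) / qpoch_inf q (t1 * t2)"
    unfolding I_def aw_integral[OF q t(2,3) nxy] ss(5) tx xy C_def h_prod_simps z_def[symmetric]
    using nzi by (simp add: qpair_def)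
  have int: "integral {0..pi} (\<lambda>\<phi>. aw_weight q t1 t2 x y \<phi> * aw_basis q t1 (cis \<phi>) k) =
      qpoch q (t1 * t2) k * aw_basis q s1 z k / qpoch q (s1 * s2) k * I" for k
    unfolding I_def integral_aw_weight_basis[OF q t(1,2,3) nxy refl] ss(5) tx by (simp add: aw_basis_def)
  have "integral {0..pi} (\<lambda>\<phi>. aw_weight q t1 t2 t3 t4 \<phi> * (aw_kernel q r t1 t2 t3 t4 \<phi> \<theta> * aw_poly q n t1 t2 t3 t4 \<phi>)) =
      integral {0..pi} (\<lambda>\<phi>. \<Sum>k\<le>n. C * G t1 t2 t3 t4 * aw_num q T Q k * aw_den q t1 t2 t3 t4 k *
        (aw_weight q t1 t2 x y \<phi> * aw_basis q t1 (cis \<phi>) k))"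
    unfolding mult.assoc[of "aw_weight q t1 t2 t3 t4 _", symmetric] aw_weight_times_kernel
      aw_poly_eq_aw_sum[OF q t(1) order.refl] aw_sum_def
    by (simp add: C_def G_def T_def Q_def x_def y_def sum_distrib_left mult_ac)
  also have "\<dots> = (\<Sum>k\<le>n. C * G t1 t2 t3 t4 * aw_num q T Q k * aw_den q t1 t2 t3 t4 k *
        integral {0..pi} (\<lambda>\<phi>. aw_weight q t1 t2 x y \<phi> * aw_basis q t1 (cis \<phi>) k))"
    by (subst integral_sum)
      (auto intro!: integrable_continuous_real continuous_intros continuous_on_aw_weight[OF q] t nxy
        simp: aw_basis_def qpoch_def)
  also have "\<dots> = (\<Sum>k\<le>n. (C * I) * G t1 t2 t3 t4 * (aw_num q T Q k * aw_den q s1 s2 s3 s4 k * aw_basis q s1 z k))"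
    unfolding int using nz by (intro sum.cong) (simp_all add: aw_den_def ss(2,3) mult_ac)
  also have "\<dots> = (C * I) * G t1 t2 t3 t4 * aw_sum q s1 s2 s3 s4 z Q n"
    by (simp add: aw_sum_def T_def ss(4) flip: sum_distrib_left)
  also have "(C * I) * G t1 t2 t3 t4 = connection_coeff q r t1 t2 n * G s1 s2 s3 s4"
  proof -
    define u v where "u = qpoch_inf q (s1 * s2 * Q)" and "v = qpoch_inf q (t1 * t2 * Q)"
    have "v \<noteq> 0"
      unfolding v_def Q_def using t by (intro qpoch_inf_nz norm_mult_q_power_less norm_mult_less_1 q)
    have 1: "C * I = qpoch q (s1 * s2) n * u / (qpoch q (t1 * t2) n * v)"
      unfolding I using qpoch_inf_shift[OF q, of "s1 * s2" n] qpoch_inf_shift[OF q, of "t1 * t2" n]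
      by (simp add: u_def v_def Q_def)
    have 2: "connection_coeff q r t1 t2 n = u / v * of_real r ^ n"
      unfolding connection_coeff_def u_def v_def ss Q_def by (simp add: mult_ac)
    have 3: "G s1 s2 s3 s4 * of_real r ^ n = qpoch q (s1 * s2) n * qpoch q (t1 * t3) n * qpoch q (t1 * t4) n / t1 ^ n"
      using r t(1) by (simp add: G_def ss(2,3)) (simp add: s power_mult_distrib)
    have "connection_coeff q r t1 t2 n * G s1 s2 s3 s4 = u / v * (G s1 s2 s3 s4 * of_real r ^ n)"
      unfolding 2 by simp
    then show ?thesis
      unfolding 1 3 using \<open>v \<noteq> 0\<close> nz by (simp add: G_def)
  qed
  finally show ?thesis
    by (simp add: aw_poly_eq_aw_sum[OF q norm_s(1) order.refl] G_def z_def Q_def)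
qed

end

end

end

section \<open>The bilinear formula\<close>

context
  fixes q :: real
  assumes q: "0 < q" "q < 1"
begin

context
  fixes a b c d :: complex
  assumes n: "a \<noteq> 0" "norm a < 1" "norm b < 1" "norm c < 1" "norm d < 1"
begin

lemma aw_gamma_nz: "aw_gamma q a b c d m \<noteq> 0"
proof -
  have "norm (complex_of_real q) < 1"
    using q by simp
  then have "1 - of_real q ^ Suc m \<noteq> (0 :: complex)"
    using one_minus_q_power_nz[OF q, of "of_real q" m] by simp
  then show ?thesis
    unfolding aw_gamma_def using n T_nz(1)[OF q n refl]
    by (simp add: one_minus_q_power_nz[OF q] norm_mult_less_1 del: right_minus_eq power_Suc)
qed

lemma aw_norm_nz: "aw_norm q m a b c d \<noteq> 0"
proof (induction m)
  case 0
  have "norm (complex_of_real q) < 1"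
    using q by simp
  then show ?case
    using n unfolding aw_norm_def
    by (simp add: qpoch_inf_nz[OF q] norm_mult_less_1)
next
  case (Suc m)
  then show ?case
    using aw_gamma_nz aw_alpha_nz[OF q n refl] by (simp add: aw_norm_Suc[OF q n refl])
qed

lemma aw_norm_tendsto: "(\<lambda>m. aw_norm q m a b c d) \<longlonglongrightarrow> 2 * of_real pi"
proof -
  define T where "T = a * b * c * d"
  have lim: "(\<lambda>m. qpoch_inf q (x * of_real q ^ (f m))) \<longlonglongrightarrow> 1" if "strict_mono f" for x and f :: "nat \<Rightarrow> nat"
  proof -
    have "(\<lambda>m. of_real q ^ f m :: complex) \<longlonglongrightarrow> 0"
      using LIMSEQ_subseq_LIMSEQ[OF tendsto_q_power[OF q] that] by (simp add: o_def)
    then have "(\<lambda>m. qpoch_inf q (x * of_real q ^ f m)) \<longlonglongrightarrow> qpoch_inf q (x * 0)"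
      by (intro tendsto_qpoch_inf[OF q] tendsto_mult tendsto_const)
    then show ?thesis
      by (simp add: qpoch_inf_0[OF q])
  qed
  have A: "qpoch q (T * of_real q ^ j) (Suc j) = qpoch_inf q (T * of_real q ^ j) / qpoch_inf q (T * of_real q ^ (2 * j + 1))" for j
  proof -
    have "norm (T * of_real q ^ (2 * j + 1)) < 1"
      using norm_T[OF q n T_def] by (intro norm_mult_q_power_less q)
    then have "qpoch_inf q (T * of_real q ^ (2 * j + 1)) \<noteq> 0"
      by (intro qpoch_inf_nz q)
    then show ?thesis
      using qpoch_inf_shift[OF q, of "T * of_real q ^ j" "Suc j"] by (simp add: mult_2_right power_add mult_ac)
  qed
  have pp: "of_real q powi (int (Suc j) - 1) = complex_of_real q ^ j" for j
    by simp
  have eq: "aw_norm q (Suc j) a b c d = 2 * of_real pi * qpoch_inf q (T * of_real q ^ (2 * Suc j)) *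
     (qpoch_inf q (T * of_real q ^ j) / qpoch_inf q (T * of_real q ^ (2 * j + 1))) /
     (qpoch_inf q (1 * of_real q ^ (Suc j + 1)) * (qpoch_inf q (a * b * of_real q ^ Suc j) * (qpoch_inf q (a * c * of_real q ^ Suc j) *
      (qpoch_inf q (a * d * of_real q ^ Suc j) * (qpoch_inf q (b * c * of_real q ^ Suc j) *
      (qpoch_inf q (b * d * of_real q ^ Suc j) * qpoch_inf q (c * d * of_real q ^ Suc j)))))))" for j
    unfolding aw_norm_def pp A T_def[symmetric] by simp
  have sm: "strict_mono (\<lambda>j. 2 * Suc j)" "strict_mono (\<lambda>j :: nat. j)" "strict_mono (\<lambda>j :: nat. 2 * j + 1)"
    "strict_mono (\<lambda>j. Suc j + 1)" "strict_mono (\<lambda>j. Suc j)"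
    by (auto simp: strict_mono_def)
  have "(\<lambda>j. aw_norm q (Suc j) a b c d) \<longlonglongrightarrow> 2 * of_real pi * 1 * (1 / 1) / (1 * (1 * (1 * (1 * (1 * (1 * 1))))))"
    unfolding eq by (intro tendsto_mult tendsto_divide tendsto_const lim sm) auto
  then have "(\<lambda>j. aw_norm q (Suc j) a b c d) \<longlonglongrightarrow> 2 * of_real pi"
    by simp
  then show ?thesis
    by (rule LIMSEQ_imp_Suc)
qed

lemma zero_aw_moments:
  assumes f: "continuous_on {0..pi} f"
    and mom: "\<And>m. integral {0..pi} (\<lambda>\<theta>. f \<theta> * aw_poly q m a b c d \<theta>) = 0"
    and \<theta>: "\<theta> \<in> {0..pi}"
  shows "f \<theta> = 0"
proof -
  let ?p = "\<lambda>m. aw_poly q m a b c d" and ?X = "\<lambda>\<theta>. complex_of_real (2 * cos \<theta>)"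
  let ?I = "\<lambda>j m. integral {0..pi} (\<lambda>\<theta>. ?X \<theta> ^ j * (f \<theta> * ?p m \<theta>))"
  have int: "(\<lambda>\<theta>. x * (?X \<theta> ^ j * (f \<theta> * ?p m \<theta>))) integrable_on {0..pi}" for x j m
    by (intro integrable_continuous_real continuous_intros f continuous_on_aw_poly[OF q n refl])
  have mult0: "x * y * (z * p) = \<alpha> * (y * (z * p1)) + \<beta> * (y * (z * p))"
    if "x * p = \<alpha> * p1 + \<beta> * p" for x y z p p1 \<alpha> \<beta> :: complex
    using that by algebra
  have mult1: "x * y * (z * p) = \<alpha> * (y * (z * p1)) + \<beta> * (y * (z * p)) + \<gamma> * (y * (z * p2))"
    if "x * p = \<alpha> * p1 + \<beta> * p + \<gamma> * p2" for x y z p p1 p2 \<alpha> \<beta> \<gamma> :: complex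
    using that by algebra
  have I: "?I j m = 0" for j m
  proof (induction j arbitrary: m)
    case 0
    show ?case
      using mom by simp
  next
    case (Suc j)
    show ?case
    proof (cases m)
      case 0
      have "?I (Suc j) 0 = integral {0..pi} (\<lambda>\<theta>. aw_alpha q (a * b * c * d) 0 * (?X \<theta> ^ j * (f \<theta> * ?p 1 \<theta>)) +
          aw_beta q a b c d 0 * (?X \<theta> ^ j * (f \<theta> * ?p 0 \<theta>)))"
      proof (rule integral_cong)
        fix \<theta> :: real
        show "?X \<theta> ^ Suc j * (f \<theta> * ?p 0 \<theta>) = aw_alpha q (a * b * c * d) 0 * (?X \<theta> ^ j * (f \<theta> * ?p 1 \<theta>)) +
          aw_beta q a b c d 0 * (?X \<theta> ^ j * (f \<theta> * ?p 0 \<theta>))"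
          unfolding power_Suc by (rule mult0[OF aw_poly_recurrence_0[OF q n refl]])
      qed
      then show ?thesis
        using Suc int 0 by (simp add: integral_add)
    next
      case (Suc k)
      have "?I (Suc j) (Suc k) = integral {0..pi} (\<lambda>\<theta>.
          aw_alpha q (a * b * c * d) (Suc k) * (?X \<theta> ^ j * (f \<theta> * ?p (Suc (Suc k)) \<theta>)) +
          aw_beta q a b c d (Suc k) * (?X \<theta> ^ j * (f \<theta> * ?p (Suc k) \<theta>)) +
          aw_gamma q a b c d k * (?X \<theta> ^ j * (f \<theta> * ?p k \<theta>)))"
      proof (rule integral_cong)
        fix \<theta> :: real
        show "?X \<theta> ^ Suc j * (f \<theta> * ?p (Suc k) \<theta>) = aw_alpha q (a * b * c * d) (Suc k) * (?X \<theta> ^ j * (f \<theta> * ?p (Suc (Suc k)) \<theta>)) +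
          aw_beta q a b c d (Suc k) * (?X \<theta> ^ j * (f \<theta> * ?p (Suc k) \<theta>)) +
          aw_gamma q a b c d k * (?X \<theta> ^ j * (f \<theta> * ?p k \<theta>))"
          unfolding power_Suc by (rule mult1[OF aw_poly_recurrence[OF q n refl]])
      qed
      then show ?thesis
        using Suc.IH int Suc by (simp add: integral_add integrable_add)
    qed
  qed
  have "integral {0..pi} (\<lambda>\<theta>. of_real (cos \<theta>) ^ j * f \<theta>) = 0" for j
  proof -
    have "integral {0..pi} (\<lambda>\<theta>. 2 ^ j * (of_real (cos \<theta>) ^ j * f \<theta>)) = 0"
      using I[of j 0] by (simp add: aw_poly_0[OF q n refl] power_mult_distrib mult.assoc)
    then show ?thesis
      by simp
  qed
  then show ?thesis
    by (rule zero_cosine_moments[OF f _ \<theta>])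
qed

lemma aw_orthogonal_series:
  assumes bounds: "\<forall>m. \<forall>\<theta>\<in>{0..pi}. norm (x m * aw_poly q m a b c d \<theta>) \<le> M m" and M: "summable M"
    and G: "\<forall>\<theta>\<in>{0..pi}. G \<theta> = (\<Sum>m. x m * aw_poly q m a b c d \<theta>)"
  shows "continuous_on {0..pi} G"
    and "continuous_on {0..pi} g \<Longrightarrow>
      (\<lambda>m. x m * integral {0..pi} (\<lambda>\<theta>. aw_weight q a b c d \<theta> * (aw_poly q m a b c d \<theta> * g \<theta>))) sums
      integral {0..pi} (\<lambda>\<theta>. aw_weight q a b c d \<theta> * (G \<theta> * g \<theta>))"
    and "integral {0..pi} (\<lambda>\<theta>. aw_weight q a b c d \<theta> * (G \<theta> * aw_poly q l a b c d \<theta>)) = x l * aw_norm q l a b c d"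
proof -
  let ?p = "\<lambda>m. aw_poly q m a b c d" and ?w = "aw_weight q a b c d"
  have bound: "norm (x m * ?p m \<theta>) \<le> M m" if "\<theta> \<in> {0..pi}" for m \<theta>
    using bounds that by blast
  have cp: "continuous_on {0..pi} (?p m)" for m
    by (rule continuous_on_aw_poly[OF q n refl])
  have cw: "continuous_on {0..pi} ?w"
    by (rule continuous_on_aw_weight[OF q n(2-5)])
  have "continuous_on {0..pi} (\<lambda>\<theta>. \<Sum>m. x m * ?p m \<theta>)"
    by (rule integral_uniform_series(1)[OF _ bound M]) (intro continuous_intros cp)
  then show "continuous_on {0..pi} G"
    by (rule continuous_on_eq) (use G in simp)
  have ser: "(\<lambda>m. x m * integral {0..pi} (\<lambda>\<theta>. ?w \<theta> * (?p m \<theta> * g \<theta>))) sums integral {0..pi} (\<lambda>\<theta>. ?w \<theta> * (G \<theta> * g \<theta>))"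
    if g: "continuous_on {0..pi} g" for g
  proof -
    have "bounded ((\<lambda>\<theta>. ?w \<theta> * g \<theta>) ` {0..pi})"
      by (intro compact_imp_bounded compact_continuous_image continuous_intros cw g) auto
    then obtain B where "\<forall>y\<in>(\<lambda>\<theta>. ?w \<theta> * g \<theta>) ` {0..pi}. norm y \<le> B"
      unfolding bounded_iff ..
    then have B: "norm (?w \<theta> * g \<theta>) \<le> B" if "\<theta> \<in> {0..pi}" for \<theta>
      using that by blast
    define f where "f = (\<lambda>m \<theta>. (?w \<theta> * g \<theta>) * (x m * ?p m \<theta>))"
    have "(\<lambda>m. integral {0..pi} (f m)) sums integral {0..pi} (\<lambda>\<theta>. \<Sum>m. f m \<theta>)"
    proof (rule integral_uniform_series(2))
      show "continuous_on {0..pi} (f m)" for m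
        unfolding f_def by (intro continuous_intros cw g cp)
      show "norm (f m \<theta>) \<le> B * M m" if "\<theta> \<in> {0..pi}" for m \<theta>
        unfolding f_def norm_mult[of "_ * _" "x m * _"]
        using B[OF that] bound[OF that, of m] order_trans[OF norm_ge_zero B[OF that]]
        by (intro mult_mono) auto
      show "summable (\<lambda>m. B * M m)"
        by (intro summable_mult M)
    qed
    moreover have "integral {0..pi} (f m) = x m * integral {0..pi} (\<lambda>\<theta>. ?w \<theta> * (?p m \<theta> * g \<theta>))" for m
      unfolding f_def by (simp add: mult_ac flip: integral_mult_right)
    moreover have "integral {0..pi} (\<lambda>\<theta>. \<Sum>m. f m \<theta>) = integral {0..pi} (\<lambda>\<theta>. ?w \<theta> * (G \<theta> * g \<theta>))"
    proof (rule integral_cong)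
      fix \<theta> :: real assume \<theta>: "\<theta> \<in> {0..pi}"
      have "summable (\<lambda>m. x m * ?p m \<theta>)"
        by (rule summable_comparison_test'[OF M, of 0]) (rule bound[OF \<theta>])
      then show "(\<Sum>m. f m \<theta>) = ?w \<theta> * (G \<theta> * g \<theta>)"
        unfolding f_def bspec[OF G \<theta>] by (subst suminf_mult) (simp_all add: mult_ac)
    qed
    ultimately show ?thesis
      by simp
  qed
  show "continuous_on {0..pi} g \<Longrightarrow>
      (\<lambda>m. x m * integral {0..pi} (\<lambda>\<theta>. ?w \<theta> * (?p m \<theta> * g \<theta>))) sums integral {0..pi} (\<lambda>\<theta>. ?w \<theta> * (G \<theta> * g \<theta>))"
    by (rule ser)
  have "(\<lambda>m. if m = l then x m * aw_norm q m a b c d else 0) sums (x l * aw_norm q l a b c d)"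
    by (rule sums_single)
  moreover have "(\<lambda>m. if m = l then x m * aw_norm q m a b c d else 0) =
      (\<lambda>m. x m * integral {0..pi} (\<lambda>\<theta>. ?w \<theta> * (?p m \<theta> * ?p l \<theta>)))"
    by (auto simp: aw_orthogonality[OF q n refl])
  ultimately have "(\<lambda>m. x m * integral {0..pi} (\<lambda>\<theta>. ?w \<theta> * (?p m \<theta> * ?p l \<theta>))) sums (x l * aw_norm q l a b c d)"
    by simp
  then show "integral {0..pi} (\<lambda>\<theta>. ?w \<theta> * (G \<theta> * ?p l \<theta>)) = x l * aw_norm q l a b c d"
    by (rule sums_unique2[OF ser[OF cp]])
qed

end

context
  fixes r :: real
  assumes r: "\<bar>r\<bar> < 1" "r \<noteq> 0"
begin

lemma connection_coeff_bound:
  assumes t: "t1 \<noteq> 0" "norm t1 < 1" "norm t2 < 1" "norm t3 < 1" "norm t4 < 1"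
  shows "\<exists>C. \<forall>n. norm (connection_coeff q r t1 t2 n / aw_norm q n t1 t2 t3 t4) \<le> C * \<bar>r\<bar> ^ n"
proof -
  have lim: "(\<lambda>n. qpoch_inf q (x * of_real q ^ n)) \<longlonglongrightarrow> 1" for x
    using tendsto_qpoch_inf[OF q tendsto_mult[OF tendsto_const tendsto_q_power[OF q]]] by (simp add: qpoch_inf_0[OF q])
  have "(\<lambda>n. qpoch_inf q (of_real r ^ 2 * t1 * t2 * of_real q ^ n) / qpoch_inf q (t1 * t2 * of_real q ^ n) /
      aw_norm q n t1 t2 t3 t4) \<longlonglongrightarrow> 1 / 1 / (2 * of_real pi)"
    by (intro tendsto_divide lim aw_norm_tendsto t) auto
  then have "Bseq (\<lambda>n. qpoch_inf q (of_real r ^ 2 * t1 * t2 * of_real q ^ n) / qpoch_inf q (t1 * t2 * of_real q ^ n) /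
      aw_norm q n t1 t2 t3 t4)"
    by (rule convergent_imp_Bseq[OF convergentI])
  then obtain C where C: "\<And>n. norm (qpoch_inf q (of_real r ^ 2 * t1 * t2 * of_real q ^ n) / qpoch_inf q (t1 * t2 * of_real q ^ n) /
      aw_norm q n t1 t2 t3 t4) \<le> C"
    by (auto simp: Bseq_def)
  have "norm (connection_coeff q r t1 t2 n / aw_norm q n t1 t2 t3 t4) \<le> C * \<bar>r\<bar> ^ n" for n
  proof -
    have "connection_coeff q r t1 t2 n / aw_norm q n t1 t2 t3 t4 = qpoch_inf q (of_real r ^ 2 * t1 * t2 * of_real q ^ n) /
        qpoch_inf q (t1 * t2 * of_real q ^ n) / aw_norm q n t1 t2 t3 t4 * of_real r ^ n"
      by (simp add: connection_coeff_def)
    then have "norm (connection_coeff q r t1 t2 n / aw_norm q n t1 t2 t3 t4) = norm (qpoch_inf q (of_real r ^ 2 * t1 * t2 * of_real q ^ n) /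
        qpoch_inf q (t1 * t2 * of_real q ^ n) / aw_norm q n t1 t2 t3 t4) * \<bar>r\<bar> ^ n"
      by (simp only: norm_mult norm_power norm_of_real)
    then show ?thesis
      using mult_right_mono[OF C[of n], of "\<bar>r\<bar> ^ n"] by simp
  qed
  then show ?thesis
    by blast
qed

context
  fixes t1 t2 t3 t4 s1 s2 s3 s4 :: complex
  assumes t: "t1 \<noteq> 0" "norm t1 < 1" "norm t2 < 1" "norm t3 < 1" "norm t4 < 1"
    and s: "s1 = t1 * of_real r" "s2 = t2 * of_real r" "s3 = t3 / of_real r" "s4 = t4 / of_real r"
    and n3: "norm s3 < 1" and n4: "norm s4 < 1"
begin

lemmas ns = norm_s[OF q r t s n3 n4]

lemma kernel_series_bound:
  "\<exists>M. summable M \<and> (\<forall>n. \<forall>\<phi>\<in>{0..pi}. \<forall>\<theta>\<in>{0..pi}.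
    norm (connection_coeff q r t1 t2 n / aw_norm q n t1 t2 t3 t4 *
      (aw_poly q n t1 t2 t3 t4 \<phi> * aw_poly q n s1 s2 s3 s4 \<theta>)) \<le> M n)"
proof -
  define \<rho> where "\<rho> = sqrt (2 / (1 + \<bar>r\<bar>))"
  have \<rho>2: "\<rho>\<^sup>2 = 2 / (1 + \<bar>r\<bar>)"
    by (simp add: \<rho>_def)
  have \<rho>: "1 < \<rho>"
    using r unfolding \<rho>_def by (simp add: field_simps)
  have small: "\<bar>r\<bar> * \<rho>\<^sup>2 < 1"
    using r unfolding \<rho>2 by (simp add: field_simps)
  obtain C where C: "\<And>n. norm (connection_coeff q r t1 t2 n / aw_norm q n t1 t2 t3 t4) \<le> C * \<bar>r\<bar> ^ n"
    using connection_coeff_bound[OF t] by blast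
  obtain A where A: "\<And>n \<phi>. \<phi> \<in> {0..pi} \<Longrightarrow> norm (aw_poly q n t1 t2 t3 t4 \<phi>) \<le> A * \<rho> ^ n"
    using aw_poly_growth[OF q t refl \<rho>] by blast
  obtain B where B: "\<And>n \<theta>. \<theta> \<in> {0..pi} \<Longrightarrow> norm (aw_poly q n s1 s2 s3 s4 \<theta>) \<le> B * \<rho> ^ n"
    using aw_poly_growth[OF q ns refl \<rho>] by blast
  show ?thesis
  proof (intro exI[of _ "\<lambda>n. C * A * B * (\<bar>r\<bar> * \<rho>\<^sup>2) ^ n"] conjI allI ballI)
    show "summable (\<lambda>n. C * A * B * (\<bar>r\<bar> * \<rho>\<^sup>2) ^ n)"
      using small by (intro summable_mult summable_geometric) (simp add: abs_mult)
    fix n \<phi> \<theta> assume "\<phi> \<in> {0..pi}" "\<theta> \<in> {0..pi}"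
    note bounds = C[of n] A[OF this(1), of n] B[OF this(2), of n]
    have "norm (connection_coeff q r t1 t2 n / aw_norm q n t1 t2 t3 t4 *
        (aw_poly q n t1 t2 t3 t4 \<phi> * aw_poly q n s1 s2 s3 s4 \<theta>)) \<le> (C * \<bar>r\<bar> ^ n) * ((A * \<rho> ^ n) * (B * \<rho> ^ n))"
      unfolding norm_mult using bounds bounds[THEN order_trans[OF norm_ge_zero]] by (intro mult_mono) auto
    also have "\<dots> = C * A * B * (\<bar>r\<bar> * \<rho>\<^sup>2) ^ n"
      by (simp add: power_mult_distrib power2_eq_square mult_ac)
    finally show "norm (connection_coeff q r t1 t2 n / aw_norm q n t1 t2 t3 t4 *
        (aw_poly q n t1 t2 t3 t4 \<phi> * aw_poly q n s1 s2 s3 s4 \<theta>)) \<le> C * A * B * (\<bar>r\<bar> * \<rho>\<^sup>2) ^ n" .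
  qed
qed

text \<open>Both sides have the same moments against \<open>w p\<^sub>m\<close>, by \<open>aw_kernel_transform\<close> and orthogonality.\<close>

lemma aw_kernel_expansion:
  assumes \<phi>: "0 < \<phi>" "\<phi> < pi" and \<theta>: "\<theta> \<in> {0..pi}"
  shows "aw_kernel q r t1 t2 t3 t4 \<phi> \<theta> = (\<Sum>n. connection_coeff q r t1 t2 n / aw_norm q n t1 t2 t3 t4 *
      (aw_poly q n t1 t2 t3 t4 \<phi> * aw_poly q n s1 s2 s3 s4 \<theta>))"
proof -
  let ?p = "\<lambda>m. aw_poly q m t1 t2 t3 t4" and ?w = "aw_weight q t1 t2 t3 t4"
  define x where "x = (\<lambda>n. connection_coeff q r t1 t2 n / aw_norm q n t1 t2 t3 t4 * aw_poly q n s1 s2 s3 s4 \<theta>)"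
  define G where "G = (\<lambda>\<phi>. \<Sum>n. x n * ?p n \<phi>)"
  define K where "K = (\<lambda>\<phi>. aw_kernel q r t1 t2 t3 t4 \<phi> \<theta>)"
  obtain M where M: "summable M" "\<forall>n. \<forall>\<phi>\<in>{0..pi}. norm (x n * ?p n \<phi>) \<le> M n"
    using kernel_series_bound \<theta> unfolding x_def by (simp only: mult_ac) blast
  have "\<forall>\<phi>\<in>{0..pi}. G \<phi> = (\<Sum>n. x n * ?p n \<phi>)"
    by (simp add: G_def)
  note G = aw_orthogonal_series[OF t M(2,1) this]
  have cw: "continuous_on {0..pi} ?w"
    by (rule continuous_on_aw_weight[OF q t(2-5)])
  have cK: "continuous_on {0..pi} K"
    unfolding K_def by (rule continuous_on_aw_kernel[OF q r])
  have cp: "continuous_on {0..pi} (?p m)" for m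
    by (rule continuous_on_aw_poly[OF q t refl])
  have "?w \<phi> * (G \<phi> - K \<phi>) = 0"
  proof (rule zero_aw_moments[OF t, where f = "\<lambda>\<phi>. ?w \<phi> * (G \<phi> - K \<phi>)"])
    show "continuous_on {0..pi} (\<lambda>\<phi>. ?w \<phi> * (G \<phi> - K \<phi>))"
      by (intro continuous_intros cw cK G(1))
    fix m
    have "integral {0..pi} (\<lambda>\<phi>. ?w \<phi> * (G \<phi> - K \<phi>) * ?p m \<phi>) =
        integral {0..pi} (\<lambda>\<phi>. ?w \<phi> * (G \<phi> * ?p m \<phi>) - ?w \<phi> * (K \<phi> * ?p m \<phi>))"
      by (simp add: algebra_simps)
    also have "\<dots> = integral {0..pi} (\<lambda>\<phi>. ?w \<phi> * (G \<phi> * ?p m \<phi>)) - integral {0..pi} (\<lambda>\<phi>. ?w \<phi> * (K \<phi> * ?p m \<phi>))"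
      by (intro integral_diff integrable_continuous_real continuous_intros cw cK cp G(1))
    also have "\<dots> = x m * aw_norm q m t1 t2 t3 t4 - connection_coeff q r t1 t2 m * aw_poly q m s1 s2 s3 s4 \<theta>"
      unfolding G(3) K_def aw_kernel_transform[OF q r t s n3 n4] ..
    also have "\<dots> = 0"
      using aw_norm_nz[OF t] by (simp add: x_def)
    finally show "integral {0..pi} (\<lambda>\<phi>. ?w \<phi> * (G \<phi> - K \<phi>) * ?p m \<phi>) = 0" .
  qed (use \<phi> in auto)
  then have "G \<phi> = K \<phi>"
    using aw_weight_nz[OF q t(2-5) \<phi>] by simp
  then show ?thesis
    by (simp add: G_def K_def x_def mult_ac)
qed

lemma aw_kernel_bilinear:
  assumes \<phi>1: "0 < \<phi>1" "\<phi>1 < pi" and \<phi>2: "0 < \<phi>2" "\<phi>2 < pi"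
  shows "(\<lambda>n. aw_norm q n s1 s2 s3 s4 * (connection_coeff q r t1 t2 n / aw_norm q n t1 t2 t3 t4)\<^sup>2 *
      aw_poly q n t1 t2 t3 t4 \<phi>1 * aw_poly q n t1 t2 t3 t4 \<phi>2) sums
    integral {0..pi} (\<lambda>\<theta>. aw_weight q s1 s2 s3 s4 \<theta> *
      (aw_kernel q r t1 t2 t3 t4 \<phi>1 \<theta> * aw_kernel q r t1 t2 t3 t4 \<phi>2 \<theta>))"
proof -
  define x where "x = (\<lambda>\<phi> n. connection_coeff q r t1 t2 n / aw_norm q n t1 t2 t3 t4 * aw_poly q n t1 t2 t3 t4 \<phi>)"
  obtain M where M: "summable M" and
    "\<forall>n. \<forall>\<phi>\<in>{0..pi}. \<forall>\<theta>\<in>{0..pi}. norm (x \<phi> n * aw_poly q n s1 s2 s3 s4 \<theta>) \<le> M n"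
    using kernel_series_bound unfolding x_def mult.assoc by blast
  then have bound: "\<forall>n. \<forall>\<theta>\<in>{0..pi}. norm (x \<phi> n * aw_poly q n s1 s2 s3 s4 \<theta>) \<le> M n"
    if "0 < \<phi>" "\<phi> < pi" for \<phi>
    using that by auto
  have K: "\<forall>\<theta>\<in>{0..pi}. aw_kernel q r t1 t2 t3 t4 \<phi> \<theta> = (\<Sum>n. x \<phi> n * aw_poly q n s1 s2 s3 s4 \<theta>)"
    if "0 < \<phi>" "\<phi> < pi" for \<phi>
    using aw_kernel_expansion[OF that] unfolding x_def mult.assoc by blast
  note S1 = aw_orthogonal_series[OF ns bound[OF \<phi>1] M K[OF \<phi>1]]
  note S2 = aw_orthogonal_series[OF ns bound[OF \<phi>2] M K[OF \<phi>2]]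
  have "integral {0..pi} (\<lambda>\<theta>. aw_weight q s1 s2 s3 s4 \<theta> * (aw_poly q n s1 s2 s3 s4 \<theta> * aw_kernel q r t1 t2 t3 t4 \<phi>2 \<theta>)) =
      x \<phi>2 n * aw_norm q n s1 s2 s3 s4" for n
    using S2(3)[of n] by (simp add: mult_ac)
  then show ?thesis
    using S1(2)[OF S2(1)] by (simp add: x_def power2_eq_square mult_ac)
qed

lemma k0_eq_integral_kernel:
  assumes \<phi>1: "0 < \<phi>1" "\<phi>1 < pi" and \<phi>2: "0 < \<phi>2" "\<phi>2 < pi"
  shows "k0 q r t1 t2 t3 t4 \<phi>1 \<phi>2 / aw_weight q t1 t2 t3 t4 \<phi>1 =
    integral {0..pi} (\<lambda>\<theta>. aw_weight q s1 s2 s3 s4 \<theta> *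
      (aw_kernel q r t1 t2 t3 t4 \<phi>1 \<theta> * aw_kernel q r t1 t2 t3 t4 \<phi>2 \<theta>))"
proof -
  define R where "R = qpoch_inf q (of_real (r\<^sup>2))"
  define D where "D = (\<lambda>\<phi> \<theta>. h_prod q [of_real r * exp (\<i> * of_real \<theta>), of_real r * exp (- \<i> * of_real \<theta>)] \<phi>)"
  define C where "C = (\<lambda>\<phi>. qpoch_inf q (of_real q) * R / (2 * of_real pi) * h_prod q [t3, t4] \<phi>)"
  have pre: "q_hermite_weight q \<phi> * R / h_prod q [t1, t2] \<phi> * (of_real (sin \<phi>) / aw_weight q t1 t2 t3 t4 \<phi>) = C \<phi>"
    if \<phi>: "0 < \<phi>" "\<phi> < pi" for \<phi>
  proof -
    define V where "V = qpochs_inf q [exp (2 * \<i> * of_real \<phi>), exp (- 2 * \<i> * of_real \<phi>)]"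
    have sin: "sin \<phi> > 0"
      using \<phi> by (rule sin_gt_zero)
    have w: "aw_weight q t1 t2 t3 t4 \<phi> = V / (h_prod q [t1, t2] \<phi> * h_prod q [t3, t4] \<phi>)"
      by (simp add: aw_weight_def V_def h_prod_def mult_ac)
    have nz: "V \<noteq> 0" "h_prod q [t1, t2] \<phi> \<noteq> 0" "h_prod q [t3, t4] \<phi> \<noteq> 0"
      using aw_weight_nz[OF q t(2-5) \<phi>] unfolding w by auto
    have "sqrt (1 - (cos \<phi>)\<^sup>2) = sin \<phi>"
      using sin by (simp add: sin_squared_eq[symmetric])
    then have "q_hermite_weight q \<phi> = qpoch_inf q (of_real q) * V / (2 * of_real pi * of_real (sin \<phi>))"
      by (simp add: q_hermite_weight_def V_def)
    then show ?thesis
      unfolding w C_def using nz sin by simp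
  qed
  have "k0 q r t1 t2 t3 t4 \<phi>1 \<phi>2 / aw_weight q t1 t2 t3 t4 \<phi>1 =
      (q_hermite_weight q \<phi>1 * R / h_prod q [t1, t2] \<phi>1 * (of_real (sin \<phi>1) / aw_weight q t1 t2 t3 t4 \<phi>1)) *
      (q_hermite_weight q \<phi>2 * R / h_prod q [t1, t2] \<phi>2 * (of_real (sin \<phi>2) / aw_weight q t1 t2 t3 t4 \<phi>2)) *
      integral {0..pi} (\<lambda>\<theta>. W0 q s1 s2 s3 s4 \<theta> / (D \<phi>1 \<theta> * D \<phi>2 \<theta>))"
    by (simp add: k0_def R_def D_def s mult_ac)
  also have "\<dots> = integral {0..pi} (\<lambda>\<theta>. C \<phi>1 * C \<phi>2 * (W0 q s1 s2 s3 s4 \<theta> / (D \<phi>1 \<theta> * D \<phi>2 \<theta>)))"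
    unfolding pre[OF \<phi>1] pre[OF \<phi>2] by (rule integral_mult_right[symmetric])
  also have "\<dots> = integral {0..pi} (\<lambda>\<theta>. aw_weight q s1 s2 s3 s4 \<theta> *
      (aw_kernel q r t1 t2 t3 t4 \<phi>1 \<theta> * aw_kernel q r t1 t2 t3 t4 \<phi>2 \<theta>))"
  proof (rule integral_cong)
    fix \<theta> :: real
    have "aw_kernel q r t1 t2 t3 t4 \<phi> \<theta> = C \<phi> * h_prod q [s1, s2] \<theta> / D \<phi> \<theta>" for \<phi>
      by (simp add: aw_kernel_def C_def R_def D_def s)
    then show "C \<phi>1 * C \<phi>2 * (W0 q s1 s2 s3 s4 \<theta> / (D \<phi>1 \<theta> * D \<phi>2 \<theta>)) = aw_weight q s1 s2 s3 s4 \<theta> *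
      (aw_kernel q r t1 t2 t3 t4 \<phi>1 \<theta> * aw_kernel q r t1 t2 t3 t4 \<phi>2 \<theta>)"
      by (simp add: W0_def power2_eq_square mult_ac)
  qed
  finally show ?thesis .
qed

end

end

end

theorem mainTheorem13:
  fixes q r \<phi>1 \<phi>2 :: real and t1 t2 t3 t4 :: complex
  assumes "0 < q" "q < 1"
    and "- 1 < r" "r < 1" "r \<noteq> 0"
    and "t1 \<noteq> 0"
    and "norm t1 < 1" "norm t2 < 1" "norm t3 < 1" "norm t4 < 1"
    and "norm (t3 / of_real r) < 1" "norm (t4 / of_real r) < 1"
    and "0 < \<phi>1" "\<phi>1 < pi" "0 < \<phi>2" "\<phi>2 < pi"
  shows "(\<lambda>n. aw_norm q n (t1 * of_real r) (t2 * of_real r) (t3 / of_real r) (t4 / of_real r) *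
              (connection_coeff q r t1 t2 n / aw_norm q n t1 t2 t3 t4)\<^sup>2 *
              aw_poly q n t1 t2 t3 t4 \<phi>1 * aw_poly q n t1 t2 t3 t4 \<phi>2)
         sums (k0 q r t1 t2 t3 t4 \<phi>1 \<phi>2 / aw_weight q t1 t2 t3 t4 \<phi>1)"
proof -
  have r: "\<bar>r\<bar> < 1"
    using assms(3,4) by simp
  note hyps = assms(1,2) r assms(5-10) refl refl refl refl assms(11-16)
  show ?thesis
    unfolding k0_eq_integral_kernel[OF hyps] by (rule aw_kernel_bilinear[OF hyps])
qed

end
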